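(* Assume that $\ell(\cdot,b):\mathbb{R}^s\to\mathbb{R}$ is $L_\ell$-smooth and convex and that each $r_i:\mathbb{R}^{d_i}\to\mathbb{R}$ ($i=1,\dots,n$) is $L_r$-smooth and convex. Let the saddle point problem described in the context be solved by the algorithm with coordinate choice described there. Then for $$\gamma=\frac14\min\left\{1;\ \frac1{L_r};\ \frac1{L_\ell};\ \sqrt{\frac{1-\tau}{s\,\lambda_{\max}(A^TA)}};\ \sqrt{\frac{1-\tau}{d\,\max_i\{\lambda_{\max}(A_i^TA_i)\}}}\right\}$$ and $\tau=1-p$, it holds that $$\mathbb{E}\left[\mathrm{gap}(\bar x^K,\bar z^K,\bar y^K)\right]=\mathcal{O}\left(\left[1+\frac{s}{\sqrt p}\sqrt{\lambda_{\max}(A^TA)}+\frac{d}{\sqrt p}\cdot\max_{i=1,\dots,n}\left\{\sqrt{\lambda_{\max}(A_iA_i^T)}\right\}+L_\ell+L_r\right]\frac{D^2}{K}\right),$$ where $\bar x^K=\frac1K\sum_{k=0}^{K-1}x^{k+1/2}$, $\bar z^K=\frac1K\sum_{k=0}^{K-1}z^{k+1/2}$, $\bar y^K=\frac1K\sum_{k=0}^{K-1}y^{k+1/2}$ and $D^2=\max_{x\in\mathcal X,z\in\mathcal Z,y\in\mathcal Y}\left[\|x^0-x\|^2+\|z^0-z\|^2+\|y^0-y\|^2\right]$.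
   Context: Setting: $n,s,d_1,\dots,d_n$ are positive integers, $d=\sum_i d_i$, $A_i\in\mathbb{R}^{s\times d_i}$, $A=[A_1,\dots,A_n]\in\mathbb{R}^{s\times d}$, $b\in\mathbb{R}^s$ is fixed, and $x=(x_1,\dots,x_n)\in\mathbb{R}^d$ with $x_i\in\mathbb{R}^{d_i}$, so $Ax=\sum_iA_ix_i$. $\ell:\mathbb{R}^s\times\mathbb{R}^s\to\mathbb{R}$, and $\nabla\ell(z,b)$ is the gradient in the first argument. The saddle point problem is $\min_{(x,z)\in\mathbb{R}^{d+s}}\max_{y\in\mathbb{R}^s}L(x,z,y)$ with $$L(x,z,y)=\ell(z,b)+\sum_{i=1}^n r_i(x_i)+y^T\Big(\sum_{i=1}^nA_ix_i-z\Big).$$ $\mathcal X\subset\mathbb{R}^d$, $\mathcal Z\subset\mathbb{R}^s$, $\mathcal Y\subset\mathbb{R}^s$ are compact sets used only to define the convergence criterion $$\mathrm{gap}(x,z,y)=\max_{\tilde y\in\mathcal Y}L(x,z,\tilde y)-\min_{\tilde x\in\mathcal X,\tilde z\in\mathcal Z}L(\tilde x,\tilde z,y).$$ A function $f$ is $L$-smooth ($L>0$) if $\|\nabla f(u)-\nabla f(v)\|\le L\|u-v\|$ for all $u,v$. Norms are Euclidean; $\lambda_{\max}$ is the largest eigenvalue; $e_j$ denotes the $j$-th standard basis vector (of $\mathbb{R}^s$ or $\mathbb{R}^{d_i}$ as appropriate). Algorithm ($n$ devices; device $i$ holds $A_i$ and $x_i$; the first device also holds $z$, $y$ and $b$): inputs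 are initial points $(x^0,z^0,y^0)\in\mathbb{R}^{d+2s}$ and $(w^0,u^0)\in\mathbb{R}^{d+s}$ with $w^0=(w_1^0,\dots,w_n^0)$, a stepsize $\gamma>0$, and the number of steps $K$; $p$ is a (positive) probability and $\tau$ a momentum parameter. For $k=0,\dots,K-1$: $x_i^{k+1/2}=\tau x_i^k+(1-\tau)w_i^k-\gamma(A_i^Tu^k+\nabla r_i(x_i^k))$ for all $i$; $z^{k+1/2}=z^k-\gamma(\nabla\ell(z^k,b)-y^k)$; $y^{k+1/2}=\tau y^k+(1-\tau)u^k+\gamma(\sum_iA_iw_i^k-z^k)$; the first device sends $y^{k+1/2}$ to the other devices; each device $i$ chooses a coordinate $c_i^k$ uniformly at random from $\{1,\dots,s\}$ and sends $\langle A_i(x_i^{k+1/2}-w_i^k),e_{c_i^k}\rangle e_{c_i^k}$ to the first device, and chooses a coordinate $j_i^k$ uniformly at random from $\{1,\dots,d_i\}$; $x_i^{k+1}=\tau x_i^k+(1-\tau)w_i^k-\gamma\big(d_i\langle A_i^T(y^{k+1/2}-u^k),e_{j_i^k}\rangle e_{j_i^k}+A_i^Tu^k+\nabla r_i(x_i^{k+1/2})\big)$ for all $i$; $z^{k+1}=z^k-\gamma(\nabla\ell(z^{k+1/2},b)-y^{k+1/2})$; $y^{k+1}=\tau y^k+(1-\tau)u^k+\gamma\big(\sum_i[s\langle A_i(x_i^{k+1/2}-w_i^k),e_{c_i^k}\rangle e_{c_i^k}+A_iw_i^k]-z^{k+1/2}\big)$; then flip a coin $b_k\in\{0,1\}$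 with $\mathbb{P}\{b_k=1\}=p$; if $b_k=1$ set $w_i^{k+1}=x_i^k$ for all $i$ and $u^{k+1}=y^k$; otherwise $w_i^{k+1}=w_i^k$ for all $i$ and $u^{k+1}=u^k$.
   Formalization: Assumes p ≤ 9/10 (the claim fails for p near 1, e.g. p=1, A=0, ℓ=r=0), and the constant in O is 1000(1+κ), where κ bounds (‖w⁰−x⁰‖²+‖u⁰−y⁰‖²)/D², since D² does not control an arbitrary (w⁰,u⁰); the sets X, Z, Y are nonempty. *)

theory Defs
  imports "HOL-Analysis.Analysis" "HOL-Probability.Probability"
begin

text \<open>
  The dimensions are carried by finite index types: \<open>'n\<close> indexes the devices, \<open>'s\<close> the rows of
  \<open>A\<close>, and \<open>'d\<close> the columns of \<open>A = [A\<^sub>1, \<dots>, A\<^sub>n]\<close>.  A map \<open>dev :: 'd \<Rightarrow> 'n\<close> tells which device holds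
  a column.  The space of device \<open>i\<close>, of dimension \<open>d\<^sub>i = card (coords dev i)\<close>, is embedded in
  \<open>real ^ 'd\<close> as the vectors that vanish outside \<open>coords dev i\<close>; this embedding preserves sums,
  inner products and norms.  A function on the space of device \<open>i\<close> is represented by a function on
  \<open>real ^ 'd\<close> that depends on \<open>block dev i v\<close> only; its gradients then vanish outside
  \<open>coords dev i\<close>, and convexity and smoothness constants are unchanged.
\<close>

definition coords :: "('d \<Rightarrow> 'n) \<Rightarrow> 'n \<Rightarrow> 'd set" where
  "coords dev i = {j. dev j = i}"

definition block :: "('d::finite \<Rightarrow> 'n) \<Rightarrow> 'n \<Rightarrow> real ^ 'd \<Rightarrow> real ^ 'd" where
  "block dev i v = (\<chi> j. if j \<in> coords dev i then v $ j else 0)"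

definition block_cols :: "('d::finite \<Rightarrow> 'n) \<Rightarrow> 'n \<Rightarrow> real ^ 'd ^ 's \<Rightarrow> real ^ 'd ^ 's" where
  "block_cols dev i A = (\<chi> a j. if j \<in> coords dev i then A $ a $ j else 0)"

text \<open>
  Eigenvectors are confined to the coordinates in \<open>J\<close>, so that the zero padding of
  \<open>block_cols dev i A\<close> does not contribute eigenvalues of its own.
\<close>

definition lambda_max_on :: "'m set \<Rightarrow> real ^ 'm ^ 'm \<Rightarrow> real" where
  "lambda_max_on J M =
     Max {c. \<exists>v. v \<noteq> 0 \<and> (\<forall>j. j \<notin> J \<longrightarrow> v $ j = 0) \<and> M *v v = c *\<^sub>R v}"

abbreviation lambda_max :: "real ^ 'm ^ 'm \<Rightarrow> real" where
  "lambda_max M \<equiv> lambda_max_on UNIV M"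

definition grad :: "('a::real_inner \<Rightarrow> real) \<Rightarrow> 'a \<Rightarrow> 'a" where
  "grad f v = (THE g. GDERIV f v :> g)"

definition smooth :: "real \<Rightarrow> ('a::real_inner \<Rightarrow> real) \<Rightarrow> bool" where
  "smooth c f \<longleftrightarrow> c > 0 \<and> (\<forall>v. \<exists>g. GDERIV f v :> g) \<and>
     (\<forall>u v. norm (grad f u - grad f v) \<le> c * norm (u - v))"

text \<open>The parameter \<open>l\<close> below stands for \<open>\<lambda>z. \<ell>(z, b)\<close>.\<close>

definition lagrangian ::
  "('d::finite \<Rightarrow> 'n::finite) \<Rightarrow> real ^ 'd ^ 's \<Rightarrow> (real ^ 's \<Rightarrow> real) \<Rightarrow> ('n \<Rightarrow> real ^ 'd \<Rightarrow> real)
    \<Rightarrow> real ^ 'd \<Rightarrow> real ^ 's \<Rightarrow> real ^ 's \<Rightarrow> real" where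
  "lagrangian dev A l r x z y =
     l z + (\<Sum>i\<in>UNIV. r i (block dev i x))
       + y \<bullet> ((\<Sum>i\<in>UNIV. block_cols dev i A *v block dev i x) - z)"

text \<open>
  Suprema and infima are used for maxima and minima; on nonempty compact sets they are attained,
  because the functions are continuous.
\<close>

definition gap ::
  "('d::finite \<Rightarrow> 'n::finite) \<Rightarrow> real ^ 'd ^ 's \<Rightarrow> (real ^ 's \<Rightarrow> real) \<Rightarrow> ('n \<Rightarrow> real ^ 'd \<Rightarrow> real)
    \<Rightarrow> (real ^ 'd) set \<Rightarrow> (real ^ 's) set \<Rightarrow> (real ^ 's) set
    \<Rightarrow> real ^ 'd \<Rightarrow> real ^ 's \<Rightarrow> real ^ 's \<Rightarrow> real" where
  "gap dev A l r X Z Y x z y =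
     (SUP y'\<in>Y. lagrangian dev A l r x z y')
       - (INF (x', z')\<in>X \<times> Z. lagrangian dev A l r x' z' y)"

definition diam2 ::
  "(real ^ 'd) set \<Rightarrow> (real ^ 's) set \<Rightarrow> (real ^ 's) set
    \<Rightarrow> real ^ 'd \<Rightarrow> real ^ 's \<Rightarrow> real ^ 's \<Rightarrow> real" where
  "diam2 X Z Y x0 z0 y0 =
     (SUP (x, z, y)\<in>X \<times> Z \<times> Y. (norm (x0 - x))\<^sup>2 + (norm (z0 - z))\<^sup>2 + (norm (y0 - y))\<^sup>2)"

text \<open>
  A bound with denominator \<open>0\<close> (which happens only for \<open>A = 0\<close>) is read as infinite, hence omitted.
\<close>

definition stepsize ::
  "('d::finite \<Rightarrow> 'n::finite) \<Rightarrow> real ^ 'd ^ 's \<Rightarrow> real \<Rightarrow> real \<Rightarrow> real \<Rightarrow> real" where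
  "stepsize dev A Lr Ll \<tau> =
     1 / 4 * Min ({1, 1 / Lr, 1 / Ll} \<union>
       {sqrt ((1 - \<tau>) / q) | q. q \<noteq> 0 \<and>
          q \<in> {real CARD('s) * lambda_max (transpose A ** A),
               real CARD('d) * (MAX i. lambda_max_on (coords dev i)
                 (transpose (block_cols dev i A) ** block_cols dev i A))}})"

text \<open>A state is \<open>(x\<^sup>k, z\<^sup>k, y\<^sup>k, w\<^sup>k, u\<^sup>k)\<close>; a half point is \<open>(x\<^bsup>k+1/2\<^esup>, z\<^bsup>k+1/2\<^esup>, y\<^bsup>k+1/2\<^esup>)\<close>.\<close>

type_synonym ('d, 's) state =
  "(real ^ 'd) \<times> (real ^ 's) \<times> (real ^ 's) \<times> (real ^ 'd) \<times> (real ^ 's)"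

type_synonym ('d, 's) half = "(real ^ 'd) \<times> (real ^ 's) \<times> (real ^ 's)"

definition half_point ::
  "('d::finite \<Rightarrow> 'n::finite) \<Rightarrow> real ^ 'd ^ 's \<Rightarrow> (real ^ 's \<Rightarrow> real) \<Rightarrow> ('n \<Rightarrow> real ^ 'd \<Rightarrow> real)
    \<Rightarrow> real \<Rightarrow> real \<Rightarrow> ('d, 's) state \<Rightarrow> ('d, 's) half" where
  "half_point dev A l r \<gamma> \<tau> = (\<lambda>(x, z, y, w, u).
     ((\<Sum>i\<in>UNIV. \<tau> *\<^sub>R block dev i x + (1 - \<tau>) *\<^sub>R block dev i w
         - \<gamma> *\<^sub>R (transpose (block_cols dev i A) *v u + grad (r i) (block dev i x))),
      z - \<gamma> *\<^sub>R (grad l z - y),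
      \<tau> *\<^sub>R y + (1 - \<tau>) *\<^sub>R u
         + \<gamma> *\<^sub>R ((\<Sum>i\<in>UNIV. block_cols dev i A *v block dev i w) - z)))"

text \<open>The update, given the coordinate choices \<open>c\<close>, \<open>j\<close> of the devices and the coin \<open>flip\<close>.\<close>

definition full_point ::
  "('d::finite \<Rightarrow> 'n::finite) \<Rightarrow> real ^ 'd ^ 's \<Rightarrow> (real ^ 's \<Rightarrow> real) \<Rightarrow> ('n \<Rightarrow> real ^ 'd \<Rightarrow> real)
    \<Rightarrow> real \<Rightarrow> real \<Rightarrow> ('n \<Rightarrow> 's) \<Rightarrow> ('n \<Rightarrow> 'd) \<Rightarrow> bool
    \<Rightarrow> ('d, 's) half \<Rightarrow> ('d, 's) state \<Rightarrow> ('d, 's) state" where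
  "full_point dev A l r \<gamma> \<tau> c j flip = (\<lambda>(xh, zh, yh) (x, z, y, w, u).
     ((\<Sum>i\<in>UNIV. \<tau> *\<^sub>R block dev i x + (1 - \<tau>) *\<^sub>R block dev i w
         - \<gamma> *\<^sub>R ((real (card (coords dev i))
                     * ((transpose (block_cols dev i A) *v (yh - u)) \<bullet> axis (j i) 1)) *\<^sub>R axis (j i) 1
                  + transpose (block_cols dev i A) *v u + grad (r i) (block dev i xh))),
      z - \<gamma> *\<^sub>R (grad l zh - yh),
      \<tau> *\<^sub>R y + (1 - \<tau>) *\<^sub>R u
         + \<gamma> *\<^sub>R ((\<Sum>i\<in>UNIV.
                    (real CARD('s)
                       * ((block_cols dev i A *v (block dev i xh - block dev i w)) \<bullet> axis (c i) 1))
                         *\<^sub>R axis (c i) 1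
                    + block_cols dev i A *v block dev i w) - zh),
      if flip then x else w,
      if flip then y else u))"

text \<open>One step returns the half point and the new state; its random choices are independent.\<close>

definition step ::
  "('d::finite \<Rightarrow> 'n::finite) \<Rightarrow> real ^ 'd ^ 's \<Rightarrow> (real ^ 's \<Rightarrow> real) \<Rightarrow> ('n \<Rightarrow> real ^ 'd \<Rightarrow> real)
    \<Rightarrow> real \<Rightarrow> real \<Rightarrow> real \<Rightarrow> ('d, 's) state \<Rightarrow> (('d, 's) half \<times> ('d, 's) state) pmf" where
  "step dev A l r \<gamma> \<tau> p st =
     bind_pmf (Pi_pmf UNIV undefined (\<lambda>_. pmf_of_set UNIV)) (\<lambda>c.
     bind_pmf (Pi_pmf UNIV undefined (\<lambda>i. pmf_of_set (coords dev i))) (\<lambda>j.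
     bind_pmf (bernoulli_pmf p) (\<lambda>flip.
       let h = half_point dev A l r \<gamma> \<tau> st
       in return_pmf (h, full_point dev A l r \<gamma> \<tau> c j flip h st))))"

text \<open>Joint law of the half points of the first \<open>K\<close> steps, in order, and the state after them.\<close>

primrec run ::
  "('d::finite \<Rightarrow> 'n::finite) \<Rightarrow> real ^ 'd ^ 's \<Rightarrow> (real ^ 's \<Rightarrow> real) \<Rightarrow> ('n \<Rightarrow> real ^ 'd \<Rightarrow> real)
    \<Rightarrow> real \<Rightarrow> real \<Rightarrow> real \<Rightarrow> ('d, 's) state \<Rightarrow> nat \<Rightarrow> (('d, 's) half list \<times> ('d, 's) state) pmf" where
  "run dev A l r \<gamma> \<tau> p st 0 = return_pmf ([], st)"
| "run dev A l r \<gamma> \<tau> p st (Suc K) =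
     bind_pmf (run dev A l r \<gamma> \<tau> p st K) (\<lambda>(hs, st').
       map_pmf (\<lambda>(h, st''). (hs @ [h], st'')) (step dev A l r \<gamma> \<tau> p st'))"

definition avg :: "('a \<Rightarrow> 'v::real_vector) \<Rightarrow> 'a list \<Rightarrow> 'v" where
  "avg f hs = (1 / real (length hs)) *\<^sub>R (\<Sum>h\<leftarrow>hs. f h)"

end

theory Submission
  imports Defs
begin

text \<open>
  View a state \<open>e = (x, z, y, w, u)\<close> as one vector and compare it with \<open>q = (x', z', y', x', y')\<close>.  The
  extragradient identity, convexity, and the bounds \<open>p / (16 \<gamma>\<^sup>2)\<close> times
  \<open>\<parallel>y\<^bsup>k+1/2\<^esup> - u\<^sup>k\<parallel>\<^sup>2\<close>, \<open>\<parallel>x\<^bsup>k+1/2\<^esup> - w\<^sup>k\<parallel>\<^sup>2\<close> on the second moments of the coordinate estimates show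
  that in expectation one step decreases \<open>\<parallel>e - q\<parallel>\<^sup>2\<close> by \<open>2 \<gamma> (L(x\<^bsup>k+1/2\<^esup>, z\<^bsup>k+1/2\<^esup>, y') - L(x', z', y\<^bsup>k+1/2\<^esup>))\<close>, with a
  surplus of a fifth of the variance of the step.  The gap takes the supremum over \<open>q\<close> inside the
  expectation.  The step noises \<open>N\<^sub>k\<close> are martingale differences and meet \<open>q\<close> only in
  \<open>(\<Sum> N\<^sub>k) \<bullet> q\<close>, so Young's inequality separates \<open>q\<close> from \<open>\<parallel>\<Sum> N\<^sub>k\<parallel>\<^sup>2\<close>, whose expectation is the
  sum of the variances and is absorbed by the surplus.
\<close>

subsection \<open>Noisy descent along a Markov chain\<close>

text \<open>For a fixed comparison point the descent telescopes in expectation, but the point that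
  attains the gap depends on the run, so a pathwise bound is needed. It exists because
  \<open>(norm (e' - q))\<^sup>2\<close> has the deterministic leading term
  \<open>(norm q)\<^sup>2\<close>: its deviation from the conditional mean is affine in
  \<open>q\<close>, with a slope driven by the noise alone. The surplus that pays for this slope
  comes from the anchor. The variance of the coin is at most \<open>\<tau> * (norm (xh - x))\<^sup>2
  + (1 - \<tau>) * (norm (xh - w))\<^sup>2\<close> (likewise for \<open>y\<close>), and these are
  the negative terms of the extragradient identity. Giving up a fifth of them leaves four fifths for
  the Young terms; the tight one carries the weight \<tau>, which is why \<open>p\<close> has to
  stay away from 1. The sampling noise of the \<open>x\<close>-update is measured by the dual anchor
  displacement and that of the \<open>y\<close>-update by the primal one, so each update absorbs the
  noise of the other.\<close>

lemma expectation_bind_pmf: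
  fixes h :: "'b \<Rightarrow> 'c::{banach, second_countable_topology}"
  assumes "finite (set_pmf p)" "\<And>x. x \<in> set_pmf p \<Longrightarrow> finite (set_pmf (f x))"
  shows "measure_pmf.expectation (bind_pmf p f) h =
    measure_pmf.expectation p (\<lambda>x. measure_pmf.expectation (f x) h)"
  using assms by (subst pmf_expectation_bind[of "set_pmf p"]) (auto simp: integral_measure_pmf[of "set_pmf p"])

text \<open>Centred noise has zero mean inner product with the deterministic \<open>S\<close>.
  Applied conditionally at every step, this makes the variances add up in the second moment of the
  summed noise.\<close>

lemma expectation_norm_add_noise:
  fixes f :: "'a \<Rightarrow> 'e::euclidean_space"
  assumes "finite (set_pmf M)"
  shows "measure_pmf.expectation M (\<lambda>x. (norm (S + (f x - measure_pmf.expectation M f)))\<^sup>2) =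
    (norm S)\<^sup>2 + measure_pmf.expectation M (\<lambda>x. (norm (f x - measure_pmf.expectation M f))\<^sup>2)"
proof -
  note [simp] = integrable_measure_pmf_finite[OF assms]
  let ?m = "measure_pmf.expectation M f"
  have "measure_pmf.expectation M (\<lambda>x. (norm (S + (f x - ?m)))\<^sup>2) =
    measure_pmf.expectation M (\<lambda>x. (norm S)\<^sup>2 + 2 * (S \<bullet> (f x - ?m)) + (norm (f x - ?m))\<^sup>2)"
    by (rule Bochner_Integration.integral_cong) (auto simp: power2_norm_eq_inner inner_simps inner_commute)
  also have "\<dots> = (norm S)\<^sup>2 + 2 * measure_pmf.expectation M (\<lambda>x. S \<bullet> (f x - ?m)) +
      measure_pmf.expectation M (\<lambda>x. (norm (f x - ?m))\<^sup>2)"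
    by simp
  also have "measure_pmf.expectation M (\<lambda>x. S \<bullet> (f x - ?m)) = S \<bullet> measure_pmf.expectation M (\<lambda>x. f x - ?m)"
    by (rule integral_inner_right) simp
  finally show ?thesis by simp
qed

text \<open>Moving the centre from \<open>b\<close> to \<open>a\<close> involves \<open>f\<close>
  only through its mean, since the cross term is linear. With \<open>b\<close> the initial state
  this isolates the comparison point; with \<open>b\<close> the mean it compares variance and second
  moment.\<close>

lemma expectation_norm_diff:
  fixes f :: "'a \<Rightarrow> 'e::euclidean_space"
  assumes "finite (set_pmf M)"
  shows "measure_pmf.expectation M (\<lambda>x. (norm (f x - a))\<^sup>2) =
    measure_pmf.expectation M (\<lambda>x. (norm (f x - b))\<^sup>2)
      - 2 * ((measure_pmf.expectation M f - b) \<bullet> (a - b)) + (norm (a - b))\<^sup>2"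
proof -
  note [simp] = integrable_measure_pmf_finite[OF assms]
  have "measure_pmf.expectation M (\<lambda>x. (norm (f x - a))\<^sup>2) =
    measure_pmf.expectation M (\<lambda>x. (norm (f x - b))\<^sup>2 - 2 * ((f x - b) \<bullet> (a - b)) + (norm (a - b))\<^sup>2)"
    by (rule Bochner_Integration.integral_cong) (auto simp: power2_norm_eq_inner inner_simps inner_commute)
  also have "\<dots> = measure_pmf.expectation M (\<lambda>x. (norm (f x - b))\<^sup>2)
     - 2 * measure_pmf.expectation M (\<lambda>x. (f x - b) \<bullet> (a - b)) + (norm (a - b))\<^sup>2"
    by simp
  also have "measure_pmf.expectation M (\<lambda>x. (f x - b) \<bullet> (a - b)) = measure_pmf.expectation M (\<lambda>x. f x - b) \<bullet> (a - b)"
    by (rule integral_inner_left) simp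
  finally show ?thesis by simp
qed

lemma norm_diff_expand:
  fixes e :: "'e::real_inner"
  shows "(norm (e - a))\<^sup>2 = (norm (e - b))\<^sup>2 - 2 * ((e - b) \<bullet> (a - b)) + (norm (a - b))\<^sup>2"
  by (simp add: power2_norm_eq_inner inner_simps inner_commute)

text \<open>
  \<open>S\<close> accumulates the noise \<open>e' - m e\<close> of the steps, and \<open>B\<close> the fluctuations of
  \<open>(norm (e' - e0))\<^sup>2\<close> minus \<open>c * v e\<close>.  The point \<open>q\<close> enters the pathwise bound only through the
  linear term in \<open>S\<close>, so it may be chosen after the randomness; the gain \<open>c * v e\<close> per step pays
  for the second moment of \<open>S\<close>.
\<close>

lemma run_coupling:
  fixes \<kappa> :: "'e::euclidean_space \<Rightarrow> ('h \<times> 'e) pmf" and rn :: "nat \<Rightarrow> ('h list \<times> 'e) pmf"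
    and e0 :: 'e and g :: "'h \<Rightarrow> 'e \<Rightarrow> real" and c :: real
  defines "m \<equiv> \<lambda>e. measure_pmf.expectation (\<kappa> e) snd"
  defines "v \<equiv> \<lambda>e. measure_pmf.expectation (\<kappa> e) (\<lambda>t. (norm (snd t - m e))\<^sup>2)"
  assumes rn0: "rn 0 = return_pmf ([], e0)"
    and rnSuc: "\<And>K. rn (Suc K) =
      bind_pmf (rn K) (\<lambda>(hs, e). map_pmf (\<lambda>(h, e'). (hs @ [h], e')) (\<kappa> e))"
    and fin: "\<And>e. finite (set_pmf (\<kappa> e))"
    and descent: "\<And>e h q. h \<in> fst ` set_pmf (\<kappa> e) \<Longrightarrow> q \<in> Q \<Longrightarrow>
      measure_pmf.expectation (\<kappa> e) (\<lambda>t. (norm (snd t - q))\<^sup>2) + c * v e + g h q \<le> (norm (e - q))\<^sup>2"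
  shows "\<exists>\<Omega> :: (('h list \<times> 'e) \<times> 'e \<times> real) pmf. finite (set_pmf \<Omega>) \<and> map_pmf fst \<Omega> = rn K \<and>
    (\<forall>((hs, e), S, B) \<in> set_pmf \<Omega>. length hs = K \<and>
      (\<forall>q\<in>Q. (\<Sum>h\<leftarrow>hs. g h q) + (norm (e - q))\<^sup>2 \<le> (norm (e0 - q))\<^sup>2 + B - 2 * (S \<bullet> (q - e0)))) \<and>
    measure_pmf.expectation \<Omega> (\<lambda>(_, S, B). B + c * (norm S)\<^sup>2) = 0"
proof (induction K)
  case 0
  show ?case
    by (rule exI[of _ "return_pmf (([], e0), 0, 0)"]) (simp add: rn0)
next
  case (Suc K)
  then obtain \<Omega> :: "(('h list \<times> 'e) \<times> 'e \<times> real) pmf" where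
    fin\<Omega>: "finite (set_pmf \<Omega>)" and marg: "map_pmf fst \<Omega> = rn K"
    and path: "\<And>hs e S B. ((hs, e), S, B) \<in> set_pmf \<Omega> \<Longrightarrow> length hs = K \<and>
      (\<forall>q\<in>Q. (\<Sum>h\<leftarrow>hs. g h q) + (norm (e - q))\<^sup>2 \<le> (norm (e0 - q))\<^sup>2 + B - 2 * (S \<bullet> (q - e0)))"
    and mean: "measure_pmf.expectation \<Omega> (\<lambda>(_, S, B). B + c * (norm S)\<^sup>2) = 0"
    by fast
  \<comment> \<open>The law \<open>rn K\<close> forgets the intermediate states on which
    \<open>S\<close> and \<open>B\<close> depend, so both are carried along in an enlarged chain
    whose first marginal is \<open>rn\<close>. The term \<open>s e\<close> is the conditional mean
    of \<open>(norm (e' - e0))\<^sup>2\<close>.\<close>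
  define s where "s e = measure_pmf.expectation (\<kappa> e) (\<lambda>t. (norm (snd t - e0))\<^sup>2)" for e
  define next' where "next' = (\<lambda>((hs, e), S, B). map_pmf (\<lambda>(h, e').
    (((hs @ [h], e'), S + (e' - m e), B + (norm (e' - e0))\<^sup>2 - s e - c * v e)
      :: (('h list \<times> 'e) \<times> 'e \<times> real))) (\<kappa> e))"
  define \<Omega>' where "\<Omega>' = bind_pmf \<Omega> next'"
  have fin_next: "finite (set_pmf (next' \<omega>))" for \<omega>
    by (cases \<omega>) (auto simp: next'_def fin)
  have finite': "finite (set_pmf \<Omega>')"
    using fin\<Omega> fin_next by (simp add: \<Omega>'_def)
  have marg': "map_pmf fst \<Omega>' = rn (Suc K)"
    unfolding \<Omega>'_def rnSuc marg[symmetric] map_bind_pmf bind_map_pmf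
    by (intro bind_pmf_cong refl) (auto simp: next'_def map_pmf_comp case_prod_unfold)
  have path': "length hs' = Suc K \<and> (\<forall>q\<in>Q. (\<Sum>h\<leftarrow>hs'. g h q) + (norm (e' - q))\<^sup>2
      \<le> (norm (e0 - q))\<^sup>2 + B' - 2 * (S' \<bullet> (q - e0)))"
    if in': "((hs', e'), S', B') \<in> set_pmf \<Omega>'" for hs' e' S' B'
  proof -
    from in' obtain hs e S B h where in\<Omega>: "((hs, e), S, B) \<in> set_pmf \<Omega>"
      and in\<kappa>: "(h, e') \<in> set_pmf (\<kappa> e)" and hs': "hs' = hs @ [h]" and S': "S' = S + (e' - m e)"
      and B': "B' = B + (norm (e' - e0))\<^sup>2 - s e - c * v e"
      by (auto simp: \<Omega>'_def next'_def)
    have "(\<Sum>h\<leftarrow>hs'. g h q) + (norm (e' - q))\<^sup>2 \<le> (norm (e0 - q))\<^sup>2 + B' - 2 * (S' \<bullet> (q - e0))"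
      if q: "q \<in> Q" for q
    proof -
      have 1: "(\<Sum>h\<leftarrow>hs. g h q) + (norm (e - q))\<^sup>2 \<le> (norm (e0 - q))\<^sup>2 + B - 2 * (S \<bullet> (q - e0))"
        using path[OF in\<Omega>] q by blast
      \<comment> \<open>Expanding the mean and the realised squared distance about \<open>e0\<close>
        produces the same term \<open>(norm (q - e0))\<^sup>2\<close>. It cancels, which leaves
        \<open>q\<close> only in the inner product with the increment of \<open>S\<close>.\<close>
      have 2: "s e - 2 * ((m e - e0) \<bullet> (q - e0)) + (norm (q - e0))\<^sup>2 + c * v e + g h q \<le> (norm (e - q))\<^sup>2"
        using descent[of h e q] in\<kappa> q unfolding s_def m_def expectation_norm_diff[OF fin, of _ snd q e0] by force
      have 3: "S' \<bullet> (q - e0) = S \<bullet> (q - e0) + (e' - e0) \<bullet> (q - e0) - (m e - e0) \<bullet> (q - e0)"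
        unfolding S' by (simp add: inner_simps)
      show ?thesis
        using 1 2 unfolding hs' B' 3 norm_diff_expand[of e' q e0] by simp
    qed
    with path[OF in\<Omega>] show ?thesis by (simp add: hs')
  qed
  \<comment> \<open>On average \<open>B\<close> loses \<open>c * v e\<close> while
    \<open>c * (norm S)\<^sup>2\<close> gains the same amount, so their sum is a martingale.\<close>
  have cond: "measure_pmf.expectation (next' \<omega>) (\<lambda>(_, S, B). B + c * (norm S)\<^sup>2) =
    (case \<omega> of (_, S, B) \<Rightarrow> B + c * (norm S)\<^sup>2)" for \<omega>
  proof -
    obtain hs e S B where \<omega>: "\<omega> = ((hs, e), S, B)" by (metis surj_pair)
    note [simp] = integrable_measure_pmf_finite[OF fin]
    have "measure_pmf.expectation (next' \<omega>) (\<lambda>(_, S, B). B + c * (norm S)\<^sup>2) =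
      measure_pmf.expectation (\<kappa> e) (\<lambda>t. (B - s e - c * v e) + (norm (snd t - e0))\<^sup>2
         + c * (norm (S + (snd t - m e)))\<^sup>2)"
      by (simp add: \<omega> next'_def case_prod_unfold algebra_simps)
    also have "\<dots> = (B - s e - c * v e) + s e
      + c * measure_pmf.expectation (\<kappa> e) (\<lambda>t. (norm (S + (snd t - m e)))\<^sup>2)"
      by (simp add: s_def)
    also have "\<dots> = B + c * (norm S)\<^sup>2"
      unfolding m_def expectation_norm_add_noise[OF fin]
      by (simp add: v_def m_def algebra_simps)
    finally show ?thesis by (simp add: \<omega>)
  qed
  have "measure_pmf.expectation \<Omega>' (\<lambda>(_, S, B). B + c * (norm S)\<^sup>2) = 0"
    unfolding \<Omega>'_def by (subst expectation_bind_pmf) (use fin\<Omega> fin_next cond mean in auto)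
  with finite' marg' path' show ?case by blast
qed

text \<open>The assumption on \<open>\<Phi>\<close> bounds it by the supremum of the accumulated
  \<open>g\<close> over \<open>Q\<close>, phrased through arbitrary upper bounds \<open>M\<close>.
  As \<open>M\<close> may depend on the outcome, the supremum stays inside the expectation. In the
  factor, 1 stems from the initial distance and \<open>1 / c\<close> from Young's
  inequality.\<close>

lemma expectation_run_le:
  fixes \<kappa> :: "'e::euclidean_space \<Rightarrow> ('h \<times> 'e) pmf" and rn :: "nat \<Rightarrow> ('h list \<times> 'e) pmf"
    and e0 :: 'e and g :: "'h \<Rightarrow> 'e \<Rightarrow> real" and c :: real
  assumes rn0: "rn 0 = return_pmf ([], e0)"
    and rnSuc: "\<And>K. rn (Suc K) =
      bind_pmf (rn K) (\<lambda>(hs, e). map_pmf (\<lambda>(h, e'). (hs @ [h], e')) (\<kappa> e))"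
    and fin: "\<And>e. finite (set_pmf (\<kappa> e))"
    and descent: "\<And>e h q. h \<in> fst ` set_pmf (\<kappa> e) \<Longrightarrow> q \<in> Q \<Longrightarrow>
      measure_pmf.expectation (\<kappa> e) (\<lambda>t. (norm (snd t - q))\<^sup>2)
        + c * measure_pmf.expectation (\<kappa> e)
            (\<lambda>t. (norm (snd t - measure_pmf.expectation (\<kappa> e) snd))\<^sup>2)
        + g h q \<le> (norm (e - q))\<^sup>2"
    and c: "c > 0"
    and D: "\<And>q. q \<in> Q \<Longrightarrow> (norm (e0 - q))\<^sup>2 \<le> D"
    and \<Phi>: "\<And>hs M. length hs = K \<Longrightarrow> (\<And>q. q \<in> Q \<Longrightarrow> (\<Sum>h\<leftarrow>hs. g h q) \<le> M) \<Longrightarrow> \<Phi> hs \<le> M"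
  shows "measure_pmf.expectation (rn K) (\<lambda>(hs, _). \<Phi> hs) \<le> (1 + 1 / c) * D"
proof -
  obtain \<Omega> :: "(('h list \<times> 'e) \<times> 'e \<times> real) pmf" where
    fin\<Omega>: "finite (set_pmf \<Omega>)" and marg: "map_pmf fst \<Omega> = rn K"
    and path: "\<forall>((hs, e), S, B) \<in> set_pmf \<Omega>. length hs = K \<and>
      (\<forall>q\<in>Q. (\<Sum>h\<leftarrow>hs. g h q) + (norm (e - q))\<^sup>2 \<le> (norm (e0 - q))\<^sup>2 + B - 2 * (S \<bullet> (q - e0)))"
    and mean: "measure_pmf.expectation \<Omega> (\<lambda>(_, S, B). B + c * (norm S)\<^sup>2) = 0"
    by (rule exE[OF run_coupling[where g = g and c = c and Q = Q and K = K, OF rn0 rnSuc fin]],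
      erule (1) descent, elim conjE, rule that)
  note [simp] = integrable_measure_pmf_finite[OF fin\<Omega>]
  have "\<Phi> hs \<le> (1 + 1 / c) * D + (B + c * (norm S)\<^sup>2)"
    if in\<Omega>: "((hs, e), S, B) \<in> set_pmf \<Omega>" for hs e S B
  proof (rule \<Phi>)
    fix q assume q: "q \<in> Q"
    \<comment> \<open>Young's inequality, weighted so that the term in \<open>S\<close> is exactly
      the one that \<open>B\<close> cancels in mean.\<close>
    have "0 \<le> (norm (c *\<^sub>R S + (q - e0)))\<^sup>2 / c" using c by simp
    also have "\<dots> = c * (norm S)\<^sup>2 + 2 * (S \<bullet> (q - e0)) + (norm (e0 - q))\<^sup>2 / c"
      using c by (simp add: power2_norm_eq_inner inner_simps inner_commute field_simps)
    finally have 1: "- 2 * (S \<bullet> (q - e0)) \<le> c * (norm S)\<^sup>2 + (norm (e0 - q))\<^sup>2 / c" by simp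
    have "(\<Sum>h\<leftarrow>hs. g h q) + (norm (e - q))\<^sup>2 \<le> (norm (e0 - q))\<^sup>2 + B - 2 * (S \<bullet> (q - e0))"
      using path in\<Omega> q by fast
    moreover have "(norm (e0 - q))\<^sup>2 / c \<le> D / c" using D[OF q] c by (simp add: divide_right_mono)
    moreover have "0 \<le> (norm (e - q))\<^sup>2" by simp
    ultimately have "(\<Sum>h\<leftarrow>hs. g h q) \<le> D + D / c + (B + c * (norm S)\<^sup>2)"
      using 1 D[OF q] by linarith
    then show "(\<Sum>h\<leftarrow>hs. g h q) \<le> (1 + 1 / c) * D + (B + c * (norm S)\<^sup>2)"
      by (simp add: algebra_simps)
  qed (use path in\<Omega> in fast)
  then have "measure_pmf.expectation \<Omega> (\<lambda>\<omega>. \<Phi> (fst (fst \<omega>)))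
    \<le> measure_pmf.expectation \<Omega> (\<lambda>\<omega>. (1 + 1 / c) * D + (case \<omega> of (_, S, B) \<Rightarrow> B + c * (norm S)\<^sup>2))"
    by (intro integral_mono_AE) (auto simp: AE_measure_pmf_iff)
  also have "\<dots> = (1 + 1 / c) * D"
    using mean by simp
  finally show ?thesis
    by (simp add: marg[symmetric] case_prod_unfold)
qed

subsection \<open>Extragradient steps with an anchor\<close>

text \<open>The full point is \<open>xh - \<gamma> *\<^sub>R (\<xi> + \<delta>)\<close>: only the
  change of direction between half and full step is charged at second order in \<gamma>. Expanding
  the weighted squares around \<open>xh - q\<close> makes everything cancel from \<open>b0\<close>
  except its inner product with \<open>xh - q\<close>.\<close>

lemma anchored_step_pointwise:
  fixes x w xh q b0 \<delta> \<xi> :: "'v::real_inner"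
  assumes "xh = \<tau> *\<^sub>R x + (1 - \<tau>) *\<^sub>R w - \<gamma> *\<^sub>R b0"
  shows "(norm (\<tau> *\<^sub>R x + (1 - \<tau>) *\<^sub>R w - \<gamma> *\<^sub>R (\<xi> + b0 + \<delta>) - q))\<^sup>2 =
    \<tau> * (norm (x - q))\<^sup>2 + (1 - \<tau>) * (norm (w - q))\<^sup>2
      - \<tau> * (norm (xh - x))\<^sup>2 - (1 - \<tau>) * (norm (xh - w))\<^sup>2
      - 2 * \<gamma> * ((\<xi> + b0 + \<delta>) \<bullet> (xh - q)) + \<gamma>\<^sup>2 * (norm (\<xi> + \<delta>))\<^sup>2"
proof -
  define H where "H = xh - q"
  have *: "\<tau> *\<^sub>R x + (1 - \<tau>) *\<^sub>R w - \<gamma> *\<^sub>R (\<xi> + b0 + \<delta>) - q = H - \<gamma> *\<^sub>R (\<xi> + \<delta>)"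
    unfolding H_def assms by (simp add: scaleR_add_right)
  have avg: "\<tau> *\<^sub>R (x - q) + (1 - \<tau>) *\<^sub>R (w - q) = H + \<gamma> *\<^sub>R b0"
    unfolding H_def assms by (simp add: scaleR_diff_right scaleR_diff_left)
  have "(norm (H - \<gamma> *\<^sub>R (\<xi> + \<delta>)))\<^sup>2 =
    (norm H)\<^sup>2 - 2 * \<gamma> * ((\<xi> + \<delta>) \<bullet> H) + \<gamma>\<^sup>2 * (norm (\<xi> + \<delta>))\<^sup>2"
    unfolding norm_diff_expand[of H "\<gamma> *\<^sub>R (\<xi> + \<delta>)" 0]
    by (simp add: power_mult_distrib inner_commute)
  moreover have "\<tau> * (norm (x - q))\<^sup>2 - \<tau> * (norm (xh - x))\<^sup>2 = 2 * (H \<bullet> (\<tau> *\<^sub>R (x - q))) - \<tau> * (norm H)\<^sup>2"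
    unfolding norm_diff_expand[of xh x q] H_def[symmetric] by (simp only: inner_scaleR_right, algebra)
  moreover have "(1 - \<tau>) * (norm (w - q))\<^sup>2 - (1 - \<tau>) * (norm (xh - w))\<^sup>2 =
      2 * (H \<bullet> ((1 - \<tau>) *\<^sub>R (w - q))) - (1 - \<tau>) * (norm H)\<^sup>2"
    unfolding norm_diff_expand[of xh w q] H_def[symmetric] by (simp only: inner_scaleR_right, algebra)
  moreover have "H \<bullet> (\<tau> *\<^sub>R (x - q)) + H \<bullet> ((1 - \<tau>) *\<^sub>R (w - q)) = (norm H)\<^sup>2 + \<gamma> * (b0 \<bullet> H)"
    unfolding inner_add_right[symmetric] avg by (simp add: inner_add_right power2_norm_eq_inner inner_commute)
  moreover have "(\<xi> + b0 + \<delta>) \<bullet> (xh - q) = (\<xi> + \<delta>) \<bullet> H + b0 \<bullet> H"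
    by (simp add: H_def inner_add_left)
  ultimately show ?thesis unfolding * by (simp add: algebra_simps)
qed

text \<open>
  The weights are tuned to \<open>p \<le> 9 / 10\<close>: in the descent estimate the coefficient \<open>5 / 64\<close> of the
  gradient increments has to stay below \<open>4 / 5 * \<tau>\<close>, where \<open>\<tau> \<ge> 1 / 10\<close>.
\<close>

lemma norm_add_sq_le:
  fixes \<xi> \<delta> :: "'v::real_inner"
  shows "(norm (\<xi> + \<delta>))\<^sup>2 \<le> 5 * (norm \<xi>)\<^sup>2 + 5 / 4 * (norm \<delta>)\<^sup>2"
proof -
  have "0 \<le> (norm (4 *\<^sub>R \<xi> - \<delta>))\<^sup>2" by simp
  also have "\<dots> = 16 * (norm \<xi>)\<^sup>2 - 8 * (\<xi> \<bullet> \<delta>) + (norm \<delta>)\<^sup>2"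
    unfolding norm_diff_expand[of "4 *\<^sub>R \<xi>" \<delta> 0] by (simp add: power_mult_distrib)
  finally show ?thesis
    using norm_diff_expand[of \<xi> "- \<delta>" 0] by simp
qed

text \<open>The half point \<open>xh\<close> does not depend on the sample, so the linear term sees
  only the mean of \<open>\<xi>\<close>. In the applications \<open>\<xi>\<close> is not centred:
  its mean completes the direction to the one evaluated at the half point.\<close>

lemma anchored_step:
  fixes x w xh q b0 \<delta> :: "'v::euclidean_space" and \<xi> :: "'a \<Rightarrow> 'v"
  assumes fin: "finite (set_pmf M)"
    and xh: "xh = \<tau> *\<^sub>R x + (1 - \<tau>) *\<^sub>R w - \<gamma> *\<^sub>R b0"
  shows "measure_pmf.expectation M
      (\<lambda>\<omega>. (norm (\<tau> *\<^sub>R x + (1 - \<tau>) *\<^sub>R w - \<gamma> *\<^sub>R (\<xi> \<omega> + b0 + \<delta>) - q))\<^sup>2) \<le>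
    \<tau> * (norm (x - q))\<^sup>2 + (1 - \<tau>) * (norm (w - q))\<^sup>2
      - \<tau> * (norm (xh - x))\<^sup>2 - (1 - \<tau>) * (norm (xh - w))\<^sup>2
      - 2 * \<gamma> * ((measure_pmf.expectation M \<xi> + b0 + \<delta>) \<bullet> (xh - q))
      + \<gamma>\<^sup>2 * (5 * measure_pmf.expectation M (\<lambda>\<omega>. (norm (\<xi> \<omega>))\<^sup>2) + 5 / 4 * (norm \<delta>)\<^sup>2)"
proof -
  note [simp] = integrable_measure_pmf_finite[OF fin]
  let ?C = "\<tau> * (norm (x - q))\<^sup>2 + (1 - \<tau>) * (norm (w - q))\<^sup>2
      - \<tau> * (norm (xh - x))\<^sup>2 - (1 - \<tau>) * (norm (xh - w))\<^sup>2"
  have "measure_pmf.expectation M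
      (\<lambda>\<omega>. (norm (\<tau> *\<^sub>R x + (1 - \<tau>) *\<^sub>R w - \<gamma> *\<^sub>R (\<xi> \<omega> + b0 + \<delta>) - q))\<^sup>2) \<le>
    measure_pmf.expectation M (\<lambda>\<omega>. ?C - 2 * \<gamma> * ((b0 + \<delta>) \<bullet> (xh - q)) - 2 * \<gamma> * (\<xi> \<omega> \<bullet> (xh - q))
      + \<gamma>\<^sup>2 * (5 * (norm (\<xi> \<omega>))\<^sup>2 + 5 / 4 * (norm \<delta>)\<^sup>2))"
  proof (rule integral_mono, simp, simp)
    fix \<omega>
    have "\<gamma>\<^sup>2 * (norm (\<xi> \<omega> + \<delta>))\<^sup>2 \<le> \<gamma>\<^sup>2 * (5 * (norm (\<xi> \<omega>))\<^sup>2 + 5 / 4 * (norm \<delta>)\<^sup>2)"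
      by (intro mult_left_mono norm_add_sq_le) simp
    then show "(norm (\<tau> *\<^sub>R x + (1 - \<tau>) *\<^sub>R w - \<gamma> *\<^sub>R (\<xi> \<omega> + b0 + \<delta>) - q))\<^sup>2 \<le>
      ?C - 2 * \<gamma> * ((b0 + \<delta>) \<bullet> (xh - q)) - 2 * \<gamma> * (\<xi> \<omega> \<bullet> (xh - q))
      + \<gamma>\<^sup>2 * (5 * (norm (\<xi> \<omega>))\<^sup>2 + 5 / 4 * (norm \<delta>)\<^sup>2)"
      unfolding anchored_step_pointwise[OF xh] by (simp add: inner_add_left algebra_simps)
  qed
  also have "\<dots> = ?C - 2 * \<gamma> * ((b0 + \<delta>) \<bullet> (xh - q))
      - 2 * \<gamma> * measure_pmf.expectation M (\<lambda>\<omega>. \<xi> \<omega> \<bullet> (xh - q))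
      + \<gamma>\<^sup>2 * (5 * measure_pmf.expectation M (\<lambda>\<omega>. (norm (\<xi> \<omega>))\<^sup>2) + 5 / 4 * (norm \<delta>)\<^sup>2)"
    by simp
  also have "measure_pmf.expectation M (\<lambda>\<omega>. \<xi> \<omega> \<bullet> (xh - q)) = measure_pmf.expectation M \<xi> \<bullet> (xh - q)"
    by (rule integral_inner_left) simp
  finally show ?thesis by (simp add: inner_add_left algebra_simps)
qed

lemma variance_le_second_moment:
  fixes f :: "'a \<Rightarrow> 'e::euclidean_space"
  assumes "finite (set_pmf M)"
  shows "measure_pmf.expectation M (\<lambda>x. (norm (f x - measure_pmf.expectation M f))\<^sup>2)
    \<le> measure_pmf.expectation M (\<lambda>x. (norm (f x - a))\<^sup>2)"
  unfolding expectation_norm_diff[OF assms, of f a "measure_pmf.expectation M f"] by simp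

text \<open>The left side is the variance of the anchor coin, which is paid for by the right side.
  The two differ by the squared distance from \<open>xh\<close> to
  \<open>\<tau> *\<^sub>R x + (1 - \<tau>) *\<^sub>R w\<close>.\<close>

lemma anchor_spread_le:
  fixes x w xh :: "'v::real_inner"
  shows "\<tau> * (1 - \<tau>) * (norm (x - w))\<^sup>2 \<le> \<tau> * (norm (xh - x))\<^sup>2 + (1 - \<tau>) * (norm (xh - w))\<^sup>2"
proof -
  let ?d = "x - w" and ?e = "xh - w"
  have "0 \<le> (norm (?e - \<tau> *\<^sub>R ?d))\<^sup>2" by simp
  also have "\<dots> = (norm ?e)\<^sup>2 - 2 * \<tau> * (?e \<bullet> ?d) + \<tau>\<^sup>2 * (norm ?d)\<^sup>2"
    unfolding norm_diff_expand[of ?e "\<tau> *\<^sub>R ?d" 0] by (simp add: power_mult_distrib)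
  also have "\<dots> = \<tau> * (norm (xh - x))\<^sup>2 + (1 - \<tau>) * (norm (xh - w))\<^sup>2 - \<tau> * (1 - \<tau>) * (norm (x - w))\<^sup>2"
    unfolding norm_diff_expand[of xh x w] by (simp add: power2_eq_square algebra_simps)
  finally show ?thesis by simp
qed

section \<open>Gradients and the first-order convexity inequality\<close>

lemma gderiv_unique:
  fixes f :: "'a::real_inner \<Rightarrow> real"
  assumes "GDERIV f v :> g" "GDERIV f v :> g'"
  shows "g = g'"
proof -
  have "(\<lambda>h. h \<bullet> g) = (\<lambda>h. h \<bullet> g')"
    using assms unfolding gderiv_def by (rule has_derivative_unique)
  then have "\<forall>h. h \<bullet> g = h \<bullet> g'" by (simp add: fun_eq_iff)
  from this[rule_format, of "g - g'"] have "(g - g') \<bullet> (g - g') = 0" by (simp add: inner_diff_right)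
  then show ?thesis by simp
qed

lemma grad_eqI:
  assumes "GDERIV f v :> g"
  shows "grad f v = g"
  unfolding grad_def by (rule the_equality[where P = "\<lambda>g. GDERIV f v :> g", OF assms gderiv_unique[OF _ assms]])

lemma smooth_gderiv:
  assumes "smooth c f"
  shows "GDERIV f v :> grad f v"
proof -
  from assms have "\<forall>v. \<exists>g. GDERIV f v :> g" unfolding smooth_def by (elim conjE)
  then obtain g where g: "GDERIV f v :> g" by (elim allE exE)
  show ?thesis unfolding grad_eqI[OF g] by (rule g)
qed

text \<open>Restriction to the line through \<open>u\<close> and \<open>v\<close> reduces this to
  the tangent inequality in one real variable.\<close>

lemma convex_gradient_inequality:
  fixes f :: "'a::real_inner \<Rightarrow> real"
  assumes "convex_on UNIV f" "GDERIV f u :> g"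
  shows "f u - f v \<le> g \<bullet> (u - v)"
proof -
  define \<phi> where "\<phi> t = f (u + t *\<^sub>R (v - u))" for t :: real
  have "convex_on UNIV \<phi>"
  proof (rule convex_onI)
    fix t a b :: real assume t: "0 < t" "t < 1"
    have comb: "u + ((1 - t) *\<^sub>R a + t *\<^sub>R b) *\<^sub>R d =
      (1 - t) *\<^sub>R (u + a *\<^sub>R d) + t *\<^sub>R (u + b *\<^sub>R d)" for d :: 'a
      by (simp add: scaleR_add_left scaleR_add_right scaleR_diff_left)
    show "\<phi> ((1 - t) *\<^sub>R a + t *\<^sub>R b) \<le> (1 - t) * \<phi> a + t * \<phi> b"
      unfolding \<phi>_def comb by (rule convex_onD[OF assms(1)]) (use t in auto)
  qed simp
  moreover have "(\<phi> has_real_derivative ((v - u) \<bullet> g)) (at 0)"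
  proof -
    have "(f has_derivative (\<lambda>h. h \<bullet> g)) (at (u + 0 *\<^sub>R (v - u)))"
      using assms(2) by (simp add: gderiv_def)
    then have "(\<phi> has_derivative (\<lambda>t. (t *\<^sub>R (v - u)) \<bullet> g)) (at 0)"
      unfolding \<phi>_def
      by (rule has_derivative_compose[rotated]) (rule derivative_eq_intros refl | simp)+
    then show ?thesis
      by (simp add: has_field_derivative_def mult_commute_abs)
  qed
  ultimately have "\<phi> 1 - \<phi> 0 \<ge> ((v - u) \<bullet> g) * (1 - 0)"
    by (intro convex_on_imp_above_tangent[of UNIV]) auto
  moreover have "g \<bullet> (u - v) = - ((v - u) \<bullet> g)"
    by (simp add: inner_diff_right inner_diff_left inner_commute)
  ultimately show ?thesis
    by (simp add: \<phi>_def)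
qed

subsection \<open>Largest eigenvalues of Gram matrices\<close>

lemma norm_add_scaleR_sq:
  fixes a b :: "'e::real_inner"
  shows "(norm (a + t *\<^sub>R b))\<^sup>2 = (norm a)\<^sup>2 + 2 * t * (a \<bullet> b) + t\<^sup>2 * (norm b)\<^sup>2"
  unfolding power2_norm_eq_inner
  by (simp add: inner_add_left inner_add_right inner_commute power2_eq_square[of t] algebra_simps)

lemma gram_vector:
  fixes B :: "real ^ 'm ^ 'k"
  shows "((transpose B ** B) *v v) \<bullet> w = (B *v v) \<bullet> (B *v w)"
  by (simp only: matrix_vector_mul_assoc[symmetric] transpose_matrix_vector dot_lmul_matrix)

text \<open>Eigenvectors of distinct eigenvalues are orthogonal, hence independent, hence finite in
  number. This is what gives the \<open>Max\<close> in \<open>lambda_max_on\<close> its intended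
  meaning.\<close>

lemma finite_gram_eigenvalues:
  fixes B :: "real ^ 'm::finite ^ 'k::finite"
  shows "finite {c. \<exists>v. v \<noteq> 0 \<and> (\<forall>j. j \<notin> J \<longrightarrow> v $ j = 0) \<and> (transpose B ** B) *v v = c *\<^sub>R v}"
    (is "finite ?E")
proof -
  let ?M = "transpose B ** B"
  define f where "f c = (SOME v. v \<noteq> 0 \<and> ?M *v v = c *\<^sub>R v)" for c
  have f: "f c \<noteq> 0" "?M *v f c = c *\<^sub>R f c" if "c \<in> ?E" for c
  proof -
    have "\<exists>v. v \<noteq> 0 \<and> ?M *v v = c *\<^sub>R v" using that by blast
    then have "f c \<noteq> 0 \<and> ?M *v f c = c *\<^sub>R f c" unfolding f_def by (rule someI_ex)
    then show "f c \<noteq> 0" "?M *v f c = c *\<^sub>R f c" by auto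
  qed
  have orth: "f c \<bullet> f c' = 0" if "c \<in> ?E" "c' \<in> ?E" "c \<noteq> c'" for c c'
  proof -
    have "c * (f c \<bullet> f c') = (?M *v f c) \<bullet> f c'" using f(2)[OF that(1)] by simp
    also have "\<dots> = (?M *v f c') \<bullet> f c" unfolding gram_vector by (rule inner_commute)
    also have "\<dots> = c' * (f c \<bullet> f c')" using f(2)[OF that(2)] by (simp add: inner_commute)
    finally show ?thesis using that(3) by simp
  qed
  have inj: "inj_on f ?E"
  proof (rule inj_onI, rule ccontr)
    fix c c' assume "c \<in> ?E" "c' \<in> ?E" "f c = f c'" "c \<noteq> c'"
    then show False using orth[of c c'] f(1)[of c] by simp
  qed
  have "pairwise orthogonal (f ` ?E)"
    unfolding pairwise_def orthogonal_def using orth by blast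
  moreover have "0 \<notin> f ` ?E" using f(1) by (metis (no_types, lifting) imageE)
  ultimately have "independent (f ` ?E)" by (rule pairwise_orthogonal_independent)
  then have "finite (f ` ?E)" by (rule independent_imp_finite)
  then show ?thesis using inj by (rule finite_imageD)
qed

text \<open>Compactness yields a maximizer of the Rayleigh quotient among the vectors supported in
  \<open>J\<close>, and the first-order condition there is the eigenvalue equation. So an eigenvalue
  exists, and one that bounds the quadratic form.\<close>

lemma gram_rayleigh_maximizer:
  fixes B :: "real ^ 'm::finite ^ 'k::finite"
  assumes "J \<noteq> {}" and cols: "\<And>a j. j \<notin> J \<Longrightarrow> B $ a $ j = 0"
  obtains v c where "v \<noteq> 0" "\<And>j. j \<notin> J \<Longrightarrow> v $ j = 0" "(transpose B ** B) *v v = c *\<^sub>R v"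
    "\<And>w. (\<And>j. j \<notin> J \<Longrightarrow> w $ j = 0) \<Longrightarrow> (norm (B *v w))\<^sup>2 \<le> c * (norm w)\<^sup>2"
proof -
  define S where "S = {v :: real ^ 'm. \<forall>j. j \<notin> J \<longrightarrow> v $ j = 0}"
  let ?M = "transpose B ** B"
  have "closed S"
  proof -
    have "S = (\<Inter>j\<in>-J. {v. v $ j = 0})" by (auto simp: S_def)
    moreover have "closed {v :: real ^ 'm. v $ j = 0}" for j
      by (rule closed_Collect_eq) (intro continuous_intros)+
    ultimately show ?thesis by auto
  qed
  then have "compact (sphere 0 1 \<inter> S)" by (intro compact_Int_closed) auto
  moreover obtain j0 where "j0 \<in> J" using assms(1) by auto
  then have "axis j0 1 \<in> sphere 0 1 \<inter> S" by (auto simp: S_def axis_def norm_axis_1[unfolded axis_def])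
  moreover have "continuous_on (sphere 0 1 \<inter> S) (\<lambda>v. (norm (B *v v))\<^sup>2)"
    by (intro continuous_intros linear_continuous_on matrix_vector_mul_bounded_linear)
  ultimately obtain v where v: "v \<in> sphere 0 1 \<inter> S"
    and vmax: "\<And>w. w \<in> sphere 0 1 \<inter> S \<Longrightarrow> (norm (B *v w))\<^sup>2 \<le> (norm (B *v v))\<^sup>2"
    using continuous_attains_sup[of "sphere 0 1 \<inter> S" "\<lambda>v. (norm (B *v v))\<^sup>2"] by blast
  define c where "c = (norm (B *v v))\<^sup>2"
  have ray: "(norm (B *v w))\<^sup>2 \<le> c * (norm w)\<^sup>2" if "w \<in> S" for w
  proof (cases "w = 0")
    case False
    have "(1 / norm w) *\<^sub>R w \<in> sphere 0 1 \<inter> S" using that False by (auto simp: S_def)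
    from vmax[OF this] have "(1 / norm w)\<^sup>2 * (norm (B *v w))\<^sup>2 \<le> c"
      by (simp add: c_def matrix_vector_mult_scaleR power_divide)
    then show ?thesis using False by (simp add: field_simps)
  qed simp
  \<comment> \<open>Vanishing columns make the Gram matrix map into \<open>S\<close>, so the
    residual \<open>w\<close> of the eigenvalue equation is an admissible direction of variation.
    Along it the linear coefficient is \<open>2 * (norm w)\<^sup>2\<close>, which optimality forces
    to vanish.\<close>
  have MS: "?M *v w \<in> S" for w
    by (auto simp: S_def matrix_vector_mult_def matrix_matrix_mult_def transpose_def cols)
  define w where "w = c *\<^sub>R v - ?M *v v"
  have wS: "w \<in> S" using v MS[of v] by (auto simp: S_def w_def)
  have "0 \<le> 2 * t * (norm w)\<^sup>2 + t\<^sup>2 * (c * (norm w)\<^sup>2 - (norm (B *v w))\<^sup>2)" for t :: real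
  proof -
    have "v + t *\<^sub>R w \<in> S" using v wS by (auto simp: S_def)
    from ray[OF this] have *: "(norm (B *v v + t *\<^sub>R (B *v w)))\<^sup>2 \<le> c * (norm (v + t *\<^sub>R w))\<^sup>2"
      by (simp add: matrix_vector_right_distrib matrix_vector_mult_scaleR)
    have "norm v = 1" using v by simp
    then have 1: "(norm (v + t *\<^sub>R w))\<^sup>2 = 1 + 2 * t * (v \<bullet> w) + t\<^sup>2 * (norm w)\<^sup>2"
      by (simp add: norm_add_scaleR_sq)
    have 2: "(norm (B *v v + t *\<^sub>R (B *v w)))\<^sup>2 = c + 2 * t * ((?M *v v) \<bullet> w) + t\<^sup>2 * (norm (B *v w))\<^sup>2"
      unfolding gram_vector c_def by (rule norm_add_scaleR_sq)
    have 3: "(norm w)\<^sup>2 = c * (v \<bullet> w) - (?M *v v) \<bullet> w"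
      by (simp add: power2_norm_eq_inner w_def[of] inner_diff_left[symmetric] flip: inner_scaleR_left)
    show ?thesis using * unfolding 1 2 by (subst 3) (simp add: algebra_simps)
  qed
  note quad = this
  have "norm w = 0"
  proof (rule ccontr)
    assume "norm w \<noteq> 0"
    then have pos: "0 < (norm w)\<^sup>2" by simp
    define q where "q = c * (norm w)\<^sup>2 - (norm (B *v w))\<^sup>2"
    have q: "0 \<le> q" using ray[OF wS] by (simp add: q_def)
    \<comment> \<open>A negative step small enough for the linear term to dominate; the summand 1
      covers \<open>q = 0\<close>.\<close>
    define t where "t = - (norm w)\<^sup>2 / (q + 1)"
    have "0 \<le> 2 * t * (norm w)\<^sup>2 + t\<^sup>2 * q" using quad[of t] by (simp add: q_def)
    also have "\<dots> = - ((norm w)\<^sup>2)\<^sup>2 * (q + 2) / (q + 1)\<^sup>2"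
      using q by (simp add: t_def power2_eq_square divide_simps) (simp add: algebra_simps)
    also have "\<dots> < 0" using pos q by (simp add: divide_neg_pos mult_neg_pos)
    finally show False by simp
  qed
  then have "?M *v v = c *\<^sub>R v" by (simp add: w_def)
  moreover have "v \<noteq> 0" using v by auto
  ultimately show ?thesis using that[of v c] v ray by (auto simp: S_def)
qed

text \<open>The Rayleigh maximum is one of the eigenvalues, hence at most the largest. That already
  transfers the quadratic bound, without identifying the two numbers.\<close>

lemma lambda_max_on_gram:
  fixes B :: "real ^ 'm::finite ^ 'k::finite"
  assumes "J \<noteq> {}" and "\<And>a j. j \<notin> J \<Longrightarrow> B $ a $ j = 0"
  shows "(\<And>j. j \<notin> J \<Longrightarrow> w $ j = 0) \<Longrightarrow> (norm (B *v w))\<^sup>2 \<le> lambda_max_on J (transpose B ** B) * (norm w)\<^sup>2"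
    and "lambda_max_on J (transpose B ** B) \<ge> 0"
    and "\<exists>v. v \<noteq> 0 \<and> (\<forall>j. j \<notin> J \<longrightarrow> v $ j = 0)
      \<and> (transpose B ** B) *v v = lambda_max_on J (transpose B ** B) *\<^sub>R v"
proof -
  let ?M = "transpose B ** B"
  let ?E = "{c. \<exists>v. v \<noteq> 0 \<and> (\<forall>j. j \<notin> J \<longrightarrow> v $ j = 0) \<and> ?M *v v = c *\<^sub>R v}"
  obtain v c where vc: "v \<noteq> 0" "\<And>j. j \<notin> J \<Longrightarrow> v $ j = 0" "?M *v v = c *\<^sub>R v"
    "\<And>w. (\<And>j. j \<notin> J \<Longrightarrow> w $ j = 0) \<Longrightarrow> (norm (B *v w))\<^sup>2 \<le> c * (norm w)\<^sup>2"
    using gram_rayleigh_maximizer[where B = B and J = J] assms by blast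
  have cE: "c \<in> ?E" using vc(1-3) by blast
  then have le: "c \<le> lambda_max_on J ?M"
    unfolding lambda_max_on_def by (rule Max_ge[OF finite_gram_eigenvalues])
  have "?E \<noteq> {}" using cE by blast
  then have mem: "lambda_max_on J ?M \<in> ?E"
    unfolding lambda_max_on_def by (rule Max_in[OF finite_gram_eigenvalues])
  show "(norm (B *v w))\<^sup>2 \<le> lambda_max_on J ?M * (norm w)\<^sup>2" if "\<And>j. j \<notin> J \<Longrightarrow> w $ j = 0"
    using vc(4)[OF that] mult_right_mono[OF le, of "(norm w)\<^sup>2"] by simp
  have "c * (norm v)\<^sup>2 \<ge> 0" using vc(4)[OF vc(2)] by (meson order_trans zero_le_power2)
  then have "c \<ge> 0" using vc(1) by (simp add: zero_le_mult_iff)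
  then show "lambda_max_on J ?M \<ge> 0" using le by simp
  show "\<exists>v. v \<noteq> 0 \<and> (\<forall>j. j \<notin> J \<longrightarrow> v $ j = 0) \<and> ?M *v v = lambda_max_on J ?M *\<^sub>R v"
    using mem by simp
qed

text \<open>\<open>B\<close> carries eigenvectors of \<open>transpose B ** B\<close> to eigenvectors
  of \<open>B ** transpose B\<close> with the same eigenvalue. Their images can vanish only for the
  eigenvalue 0, which is split off. This links the step size, stated with one product, to the rate,
  stated with the other.\<close>

lemma lambda_max_on_gram_le_cogram:
  fixes B :: "real ^ 'm::finite ^ 'k::finite"
  assumes "J \<noteq> {}" and "\<And>a j. j \<notin> J \<Longrightarrow> B $ a $ j = 0"
  shows "lambda_max_on J (transpose B ** B) \<le> lambda_max (B ** transpose B)"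
proof (cases "lambda_max_on J (transpose B ** B) = 0")
  case True
  then show ?thesis using lambda_max_on_gram(2)[of UNIV "transpose B"] by simp
next
  case False
  let ?c = "lambda_max_on J (transpose B ** B)"
  obtain v where v: "v \<noteq> 0" "(transpose B ** B) *v v = ?c *\<^sub>R v"
    using lambda_max_on_gram(3)[OF assms] by blast
  have "(B ** transpose B) *v (B *v v) = B *v ((transpose B ** B) *v v)"
    by (simp only: matrix_vector_mul_assoc matrix_mul_assoc)
  also have "\<dots> = ?c *\<^sub>R (B *v v)" by (simp only: v(2) matrix_vector_mult_scaleR)
  finally have eig: "(B ** transpose B) *v (B *v v) = ?c *\<^sub>R (B *v v)" .
  have nz: "B *v v \<noteq> 0"
  proof
    assume "B *v v = 0"
    then have "(transpose B ** B) *v v = 0" by (simp flip: matrix_vector_mul_assoc)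
    with v False show False by simp
  qed
  have "?c \<in> {c. \<exists>v. v \<noteq> 0 \<and> (\<forall>j. j \<notin> UNIV \<longrightarrow> v $ j = 0)
      \<and> (transpose (transpose B) ** transpose B) *v v = c *\<^sub>R v}"
    using eig nz by auto
  from Max_ge[OF finite_gram_eigenvalues this] show ?thesis
    unfolding lambda_max_on_def[of UNIV] by simp
qed

subsection \<open>Random coordinate estimates\<close>

lemma block_nth: "block dev i v $ k = (if dev k = i then v $ k else 0)"
  by (simp add: block_def coords_def)

lemma block_idem: "block dev i (block dev i v) = block dev i v"
  by (simp add: vec_eq_iff block_nth)

lemma block_diff: "block dev i x - block dev i y = block dev i (x - y)"
  by (simp add: vec_eq_iff block_nth)

lemma sum_block:
  fixes dev :: "'d::finite \<Rightarrow> 'n::finite"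
  shows "(\<Sum>i\<in>UNIV. block dev i v) = v"
  by (simp add: vec_eq_iff block_nth)

lemma sum_norm_block_sq:
  fixes dev :: "'d::finite \<Rightarrow> 'n::finite"
  shows "(\<Sum>i\<in>UNIV. (norm (block dev i v))\<^sup>2) = (norm v)\<^sup>2"
proof -
  have "(\<Sum>i\<in>UNIV. (norm (block dev i v))\<^sup>2) = (\<Sum>i\<in>UNIV. \<Sum>k\<in>UNIV. if dev k = i then (v $ k)\<^sup>2 else 0)"
    by (simp add: norm_vec_def L2_set_def sum_nonneg block_nth if_distrib[of "\<lambda>x. x\<^sup>2"] cong: if_cong)
  also have "\<dots> = (\<Sum>k\<in>UNIV. \<Sum>i\<in>UNIV. if dev k = i then (v $ k)\<^sup>2 else 0)"
    by (rule sum.swap)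
  also have "\<dots> = (norm v)\<^sup>2"
    by (simp add: norm_vec_def L2_set_def sum_nonneg)
  finally show ?thesis .
qed

lemma block_cols_mult_block: "block_cols dev i A *v block dev i v = A *v block dev i v"
  by (simp add: vec_eq_iff matrix_vector_mult_def block_cols_def block_def
      if_distrib[of "\<lambda>x. x * _"] if_distrib[of "\<lambda>x. _ * x"] cong: if_cong)

lemma transpose_block_cols_mult: "transpose (block_cols dev i A) *v y = block dev i (transpose A *v y)"
  by (simp add: vec_eq_iff matrix_vector_mult_def block_cols_def block_def transpose_def
      if_distrib[of "\<lambda>x. x * _"] cong: if_cong del: transpose_matrix_vector)

lemma sum_card_coords:
  fixes dev :: "'d::finite \<Rightarrow> 'n::finite"
  shows "(\<Sum>i\<in>UNIV. card (coords dev i)) = CARD('d)"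
proof -
  have "card (\<Union>i\<in>UNIV. coords dev i) = (\<Sum>i\<in>UNIV. card (coords dev i))"
    by (rule card_UN_disjoint) (auto simp: coords_def)
  moreover have "(\<Union>i\<in>UNIV. coords dev i) = UNIV" by (auto simp: coords_def)
  ultimately show ?thesis by simp
qed

lemma real_axis_nth: "(axis m 1 :: real ^ 'k) $ k = (if m = k then 1 else 0)"
  by (simp add: axis_def)

lemma expectation_vec_nth:
  fixes f :: "'a \<Rightarrow> real ^ 'k::finite"
  assumes "finite (set_pmf M)"
  shows "measure_pmf.expectation M f $ k = measure_pmf.expectation M (\<lambda>x. f x $ k)"
  by (rule integral_bounded_linear[OF bounded_linear_vec_nth, symmetric])
    (rule integrable_measure_pmf_finite[OF assms])

lemma expectation_norm_sq_vec:
  fixes f :: "'a \<Rightarrow> real ^ 'k::finite"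
  assumes "finite (set_pmf M)"
  shows "measure_pmf.expectation M (\<lambda>x. (norm (f x))\<^sup>2) =
    (\<Sum>k\<in>UNIV. measure_pmf.expectation M (\<lambda>x. (f x $ k)\<^sup>2))"
proof -
  note [simp] = integrable_measure_pmf_finite[OF assms]
  have "(norm (f x))\<^sup>2 = (\<Sum>k\<in>UNIV. (f x $ k)\<^sup>2)" for x
    by (simp add: norm_vec_def L2_set_def sum_nonneg)
  then show ?thesis by simp
qed

lemma expectation_Pi_pmf_component:
  fixes f :: "'b \<Rightarrow> real"
  assumes "finite I" "i \<in> I"
  shows "measure_pmf.expectation (Pi_pmf I d p) (\<lambda>g. f (g i)) = measure_pmf.expectation (p i) f"
proof -
  have "measure_pmf.expectation (Pi_pmf I d p) (\<lambda>g. f (g i)) =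
      measure_pmf.expectation (map_pmf (\<lambda>g. g i) (Pi_pmf I d p)) f"
    by simp
  then show ?thesis using assms by (simp only: Pi_pmf_component if_True)
qed

section \<open>Coordinate estimators and their moments\<close>

definition col_estimate ::
  "('d::finite \<Rightarrow> 'n::finite) \<Rightarrow> real ^ 'd ^ 's::finite \<Rightarrow> ('n \<Rightarrow> 'd) \<Rightarrow> real ^ 's \<Rightarrow> real ^ 'd" where
  "col_estimate dev A j v = (\<Sum>i\<in>UNIV. (real (card (coords dev i))
     * ((transpose (block_cols dev i A) *v v) \<bullet> axis (j i) 1)) *\<^sub>R axis (j i) 1)"

definition row_estimate ::
  "('d::finite \<Rightarrow> 'n::finite) \<Rightarrow> real ^ 'd ^ 's::finite \<Rightarrow> ('n \<Rightarrow> 's) \<Rightarrow> real ^ 'd \<Rightarrow> real ^ 's" where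
  "row_estimate dev A c v = (\<Sum>i\<in>UNIV. (real CARD('s)
     * ((block_cols dev i A *v block dev i v) \<bullet> axis (c i) 1)) *\<^sub>R axis (c i) 1)"

abbreviation col_choice :: "('d::finite \<Rightarrow> 'n::finite) \<Rightarrow> ('n \<Rightarrow> 'd) pmf" where
  "col_choice dev \<equiv> Pi_pmf UNIV undefined (\<lambda>i. pmf_of_set (coords dev i))"

abbreviation row_choice :: "('n::finite \<Rightarrow> 's::finite) pmf" where
  "row_choice \<equiv> Pi_pmf UNIV undefined (\<lambda>_. pmf_of_set UNIV)"

text \<open>Devices own disjoint columns, so at most one summand reaches coordinate
  \<open>k\<close>. A choice \<open>j i\<close> outside the columns of device \<open>i\<close> is
  annihilated by the block, so the formula holds for every \<open>j\<close>.\<close>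

lemma col_estimate_nth:
  "col_estimate dev A j v $ k =
    (if j (dev k) = k then real (card (coords dev (dev k))) * (transpose A *v v) $ k else 0)"
proof -
  have "col_estimate dev A j v $ k = (\<Sum>i\<in>UNIV. if i = dev k \<and> j i = k
      then real (card (coords dev i)) * (transpose A *v v) $ k else 0)"
    unfolding col_estimate_def transpose_block_cols_mult
    by (simp add: inner_axis block_nth real_axis_nth del: transpose_matrix_vector) (rule sum.cong, auto)
  also have "\<dots> = (\<Sum>i\<in>UNIV. if i = dev k then
      (if j (dev k) = k then real (card (coords dev (dev k))) * (transpose A *v v) $ k else 0) else 0)"
    by (rule sum.cong) auto
  finally show ?thesis by simp
qed

lemma expectation_col_choice:
  fixes dev :: "'d::finite \<Rightarrow> 'n::finite" and f :: "'d \<Rightarrow> real"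
  assumes "surj dev"
  shows "measure_pmf.expectation (col_choice dev) (\<lambda>j. f (j i)) =
    (\<Sum>k\<in>coords dev i. f k) / card (coords dev i)"
proof -
  have "coords dev i \<noteq> {}" using assms by (auto simp: coords_def surj_def) (metis)
  then show ?thesis
    by (subst expectation_Pi_pmf_component) (auto simp: integral_pmf_of_set)
qed

text \<open>A coordinate of a device with m columns is hit with probability 1/m and scaled by m,
  which is unbiased and multiplies its square by m in mean. No cross terms arise, because each
  coordinate belongs to one device.\<close>

lemma
  fixes dev :: "'d::finite \<Rightarrow> 'n::finite" and A :: "real ^ 'd ^ 's::finite"
  assumes "surj dev"
  shows expectation_col_estimate:
      "measure_pmf.expectation (col_choice dev) (\<lambda>j. col_estimate dev A j v) = transpose A *v v"
    and expectation_col_estimate_sq: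
      "measure_pmf.expectation (col_choice dev) (\<lambda>j. (norm (col_estimate dev A j v))\<^sup>2) =
        (\<Sum>i\<in>UNIV. card (coords dev i) * (norm (transpose (block_cols dev i A) *v v))\<^sup>2)"
proof -
  have fin: "finite (set_pmf (col_choice dev))" by (rule finite)
  have card: "coords dev (dev k) \<noteq> {}" for k
    by (auto simp: coords_def)
  have one: "measure_pmf.expectation (col_choice dev) (\<lambda>j. if j (dev k) = k then a else 0) =
      a / card (coords dev (dev k))" for k and a :: real
    using expectation_col_choice[OF assms, of "\<lambda>l. if l = k then a else 0" "dev k"]
    by (simp add: coords_def)
  show "measure_pmf.expectation (col_choice dev) (\<lambda>j. col_estimate dev A j v) = transpose A *v v"
    using card unfolding vec_eq_iff expectation_vec_nth[OF fin] col_estimate_nth one by simp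
  have "measure_pmf.expectation (col_choice dev) (\<lambda>j. (norm (col_estimate dev A j v))\<^sup>2) =
     (\<Sum>k\<in>UNIV. card (coords dev (dev k)) * ((transpose A *v v) $ k)\<^sup>2)"
    unfolding expectation_norm_sq_vec[OF fin] col_estimate_nth if_distrib[of "\<lambda>x. x\<^sup>2"] power_mult_distrib
      power_zero_numeral one
    using card by (simp add: power2_eq_square)
  also have "\<dots> = (\<Sum>k\<in>UNIV. \<Sum>i\<in>UNIV. if i = dev k then
      card (coords dev i) * ((transpose A *v v) $ k)\<^sup>2 else 0)"
    by simp
  also have "\<dots> = (\<Sum>i\<in>UNIV. \<Sum>k\<in>UNIV. if i = dev k then
      card (coords dev i) * ((transpose A *v v) $ k)\<^sup>2 else 0)"
    by (rule sum.swap)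
  also have "\<dots> = (\<Sum>i\<in>UNIV. card (coords dev i) * (norm (transpose (block_cols dev i A) *v v))\<^sup>2)"
    unfolding transpose_block_cols_mult
    by (rule sum.cong[OF refl], simp add: norm_vec_def L2_set_def sum_nonneg block_nth sum_distrib_left
        del: transpose_matrix_vector) (rule sum.cong, auto)
  finally show "measure_pmf.expectation (col_choice dev) (\<lambda>j. (norm (col_estimate dev A j v))\<^sup>2) =
        (\<Sum>i\<in>UNIV. card (coords dev i) * (norm (transpose (block_cols dev i A) *v v))\<^sup>2)" .
qed

lemma matrix_vector_mult_sum:
  fixes A :: "real ^ 'd::finite ^ 's::finite"
  shows "A *v (\<Sum>i\<in>I. f i) = (\<Sum>i\<in>I. A *v f i)"
  by (rule linear_sum) simp

lemma row_estimate_nth: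
  fixes A :: "real ^ 'd::finite ^ 's::finite" and dev :: "'d \<Rightarrow> 'n::finite"
  shows "row_estimate dev A c v $ k =
    (\<Sum>i\<in>UNIV. if c i = k then real CARD('s) * (A *v block dev i v) $ k else 0)"
  unfolding row_estimate_def block_cols_mult_block
  by (simp add: inner_axis real_axis_nth) (rule sum.cong, auto)

lemma expectation_row_choice_pair:
  fixes k :: "'s::finite" and i l :: "'n::finite"
  shows "measure_pmf.expectation row_choice (\<lambda>c. if c i = k \<and> c l = k then 1 else 0) =
    (if i = l then 1 / real CARD('s) else 1 / (real CARD('s))\<^sup>2)"
proof -
  \<comment> \<open>Expectations under independent choices factor over products, so the joint
    indicator is written as a product over all devices with factor 1 outside \<open>{i, l}\<close>.
    For \<open>i = l\<close> this set is a singleton, which produces the two cases.\<close>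
  let ?f = "\<lambda>m a. if m \<in> {i, l} then (if a = k then 1 else 0) else 1 :: real"
  have e1: "measure_pmf.expectation (pmf_of_set (UNIV :: 's set)) (\<lambda>a. if a = k then 1 else 0 :: real) = 1 / real CARD('s)"
    by (simp add: integral_pmf_of_set)
  have "(\<Prod>m\<in>UNIV. ?f m (c m)) = (\<Prod>m\<in>{i, l}. if c m = k then 1 else 0 :: real)" for c :: "'n \<Rightarrow> 's"
    by (rule prod.mono_neutral_cong_right) auto
  moreover have "(\<Prod>m\<in>{i, l}. if c m = k then 1 else 0) = (if c i = k \<and> c l = k then 1 else 0 :: real)"
    for c :: "'n \<Rightarrow> 's"
    by (cases "i = l") auto
  ultimately have "measure_pmf.expectation row_choice (\<lambda>c. if c i = k \<and> c l = k then 1 else 0 :: real) =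
    measure_pmf.expectation row_choice (\<lambda>c. \<Prod>m\<in>UNIV. ?f m (c m))"
    by simp
  also have "\<dots> = (\<Prod>m\<in>UNIV. measure_pmf.expectation (pmf_of_set UNIV) (?f m))"
    by (rule expectation_prod_Pi_pmf) (auto intro: integrable_measure_pmf_finite)
  also have "\<dots> = (\<Prod>m\<in>UNIV. if m \<in> {i, l} then 1 / real CARD('s) else 1)"
    by (rule prod.cong) (auto simp: e1)
  also have "\<dots> = (\<Prod>m\<in>{i, l}. 1 / real CARD('s))"
    by (rule prod.mono_neutral_cong_right) auto
  also have "\<dots> = (if i = l then 1 / real CARD('s) else 1 / (real CARD('s))\<^sup>2)"
    by (simp add: power2_eq_square)
  finally show ?thesis .
qed

text \<open>Unlike for columns, all devices write into the same space and may hit the same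
  coordinate. After scaling by the square of \<open>CARD('s)\<close>, cross terms have weight 1 and
  diagonal terms weight \<open>CARD('s)\<close>; completing the square leaves the diagonal excess
  \<open>CARD('s) - 1\<close>.\<close>

lemma
  fixes dev :: "'d::finite \<Rightarrow> 'n::finite" and A :: "real ^ 'd ^ 's::finite"
  shows expectation_row_estimate:
      "measure_pmf.expectation row_choice (\<lambda>c. row_estimate dev A c v) = A *v v"
    and expectation_row_estimate_sq:
      "measure_pmf.expectation row_choice (\<lambda>c. (norm (row_estimate dev A c v))\<^sup>2) =
        (norm (A *v v))\<^sup>2 + (real CARD('s) - 1) * (\<Sum>i\<in>UNIV. (norm (A *v block dev i v))\<^sup>2)"
proof -
  let ?s = "real CARD('s)"
  let ?R = "row_choice :: ('n \<Rightarrow> 's) pmf"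
  let ?a = "\<lambda>i k. (A *v block dev i v) $ k"
  have fin: "finite (set_pmf ?R)" by (rule finite)
  note [simp] = integrable_measure_pmf_finite[OF fin]
  have sumA: "(\<Sum>i\<in>UNIV. ?a i k) = (A *v v) $ k" for k
    by (simp only: sum_component[symmetric] matrix_vector_mult_sum[symmetric] sum_block)
  have pr: "measure_pmf.expectation ?R (\<lambda>c. if c i = k then a else 0) = a / ?s" for i k and a :: real
    by (subst expectation_Pi_pmf_component[where f = "\<lambda>l. if l = k then a else 0"])
      (simp_all add: integral_pmf_of_set)
  show "measure_pmf.expectation ?R (\<lambda>c. row_estimate dev A c v) = A *v v"
    unfolding vec_eq_iff expectation_vec_nth[OF fin] row_estimate_nth
    by (simp add: pr sumA)
  have sq: "measure_pmf.expectation ?R (\<lambda>c. (row_estimate dev A c v $ k)\<^sup>2) =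
      ((A *v v) $ k)\<^sup>2 + (?s - 1) * (\<Sum>i\<in>UNIV. (?a i k)\<^sup>2)" for k
  proof -
    have "measure_pmf.expectation ?R (\<lambda>c. (row_estimate dev A c v $ k)\<^sup>2) =
      measure_pmf.expectation ?R (\<lambda>c. \<Sum>i\<in>UNIV. \<Sum>l\<in>UNIV.
        (?s\<^sup>2 * (?a i k * ?a l k)) * (if c i = k \<and> c l = k then 1 else 0))"
      unfolding row_estimate_nth power2_eq_square sum_product
      by (intro Bochner_Integration.integral_cong refl sum.cong) auto
    also have "\<dots> = (\<Sum>i\<in>UNIV. \<Sum>l\<in>UNIV. (?s\<^sup>2 * (?a i k * ?a l k)) *
        measure_pmf.expectation ?R (\<lambda>c. if c i = k \<and> c l = k then 1 else 0))"
      by (simp del: mult_eq_0_iff)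
    also have "\<dots> = (\<Sum>i\<in>UNIV. \<Sum>l\<in>UNIV. ?a i k * ?a l k + (if i = l then (?s - 1) * (?a i k)\<^sup>2 else 0))"
      unfolding expectation_row_choice_pair
      by (intro sum.cong refl) (simp add: power2_eq_square field_simps)
    also have "\<dots> = (\<Sum>i\<in>UNIV. ?a i k)\<^sup>2 + (?s - 1) * (\<Sum>i\<in>UNIV. (?a i k)\<^sup>2)"
    proof -
      have "(\<Sum>i\<in>UNIV. ?a i k)\<^sup>2 = (\<Sum>i\<in>UNIV. \<Sum>l\<in>UNIV. ?a i k * ?a l k)"
        unfolding power2_eq_square by (rule sum_product)
      then show ?thesis by (simp add: sum.distrib sum_distrib_left)
    qed
    finally show ?thesis by (simp add: sumA)
  qed
  have nsq: "(norm w)\<^sup>2 = (\<Sum>k\<in>UNIV. (w $ k)\<^sup>2)" for w :: "real ^ 's"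
    by (simp add: norm_vec_def L2_set_def sum_nonneg)
  show "measure_pmf.expectation ?R (\<lambda>c. (norm (row_estimate dev A c v))\<^sup>2) =
        (norm (A *v v))\<^sup>2 + (?s - 1) * (\<Sum>i\<in>UNIV. (norm (A *v block dev i v))\<^sup>2)"
  proof -
    have "(\<Sum>i\<in>UNIV. (norm (A *v block dev i v))\<^sup>2) = (\<Sum>k\<in>UNIV. \<Sum>i\<in>UNIV. (?a i k)\<^sup>2)"
      unfolding nsq by (rule sum.swap)
    then show ?thesis
      unfolding expectation_norm_sq_vec[OF fin] sq nsq[of "A *v v"]
      by (simp add: sum.distrib flip: sum_distrib_left)
  qed
qed

section \<open>Block identities and eigenvalue bounds for the second moments\<close>

lemma sum_block_cols_mult_block:
  fixes dev :: "'d::finite \<Rightarrow> 'n::finite"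
  shows "(\<Sum>i\<in>UNIV. block_cols dev i A *v block dev i v) = A *v v"
  unfolding block_cols_mult_block by (simp only: matrix_vector_mult_sum[symmetric] sum_block)

lemma sum_transpose_block_cols_mult:
  fixes dev :: "'d::finite \<Rightarrow> 'n::finite"
  shows "(\<Sum>i\<in>UNIV. transpose (block_cols dev i A) *v y) = transpose A *v y"
  unfolding transpose_block_cols_mult by (rule sum_block)

lemma inner_transpose_mult:
  fixes A :: "real ^ 'd::finite ^ 's::finite"
  shows "(transpose A *v y) \<bullet> x = y \<bullet> (A *v x)"
  by (simp add: dot_lmul_matrix)

lemma inner_block: "block dev i h \<bullet> g = h \<bullet> block dev i g"
  unfolding inner_vec_def by (rule sum.cong) (auto simp: block_nth)

lemma norm_matrix_vector_sq_le:
  fixes A :: "real ^ 'd::finite ^ 's::finite"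
  shows "(norm (A *v v))\<^sup>2 \<le> lambda_max (transpose A ** A) * (norm v)\<^sup>2"
  by (rule lambda_max_on_gram(1)) auto

text \<open>A duality argument: for \<open>v = transpose B *v y\<close> one has
  \<open>(norm v)\<^sup>2 = y \<bullet> (B *v v)\<close>. The Gram bound applies to
  \<open>B *v v\<close> because \<open>v\<close> is supported on the block, and one factor
  \<open>(norm v)\<^sup>2\<close> is divided out.\<close>

lemma norm_transpose_block_cols_sq_le:
  fixes dev :: "'d::finite \<Rightarrow> 'n::finite" and A :: "real ^ 'd ^ 's::finite"
  assumes "surj dev"
  shows "(norm (transpose (block_cols dev i A) *v y))\<^sup>2 \<le>
    lambda_max_on (coords dev i) (transpose (block_cols dev i A) ** block_cols dev i A) * (norm y)\<^sup>2"
    (is "(norm ?v)\<^sup>2 \<le> ?lam * _")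
proof (cases "?v = 0")
  case True
  have "0 \<le> ?lam"
    by (rule lambda_max_on_gram(2)) (use assms in \<open>auto simp: coords_def block_cols_def surj_def, metis\<close>)
  then show ?thesis by (subst True) simp
next
  case False
  have "(norm ?v)\<^sup>2 = y \<bullet> (block_cols dev i A *v ?v)"
    by (simp only: power2_norm_eq_inner inner_transpose_mult)
  also have "\<dots> \<le> norm y * norm (block_cols dev i A *v ?v)"
    by (rule norm_cauchy_schwarz)
  finally have "((norm ?v)\<^sup>2)\<^sup>2 \<le> (norm y * norm (block_cols dev i A *v ?v))\<^sup>2"
    by (rule power_mono) simp
  also have "\<dots> \<le> (norm y)\<^sup>2 * (?lam * (norm ?v)\<^sup>2)"
    unfolding power_mult_distrib
  proof (rule mult_left_mono, rule lambda_max_on_gram(1))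
    show "coords dev i \<noteq> {}" using assms by (auto simp: coords_def surj_def) (metis)
    show "block_cols dev i A $ a $ j = 0" if "j \<notin> coords dev i" for a j
      using that by (simp add: block_cols_def)
    show "?v $ j = 0" if "j \<notin> coords dev i" for j
      unfolding transpose_block_cols_mult using that by (simp add: block_def)
  qed simp
  finally have "(norm ?v)\<^sup>2 * (norm ?v)\<^sup>2 \<le> (?lam * (norm y)\<^sup>2) * (norm ?v)\<^sup>2"
    by (simp only: power2_eq_square[of "(norm ?v)\<^sup>2"] mult_ac)
  moreover have "0 < (norm ?v)\<^sup>2" using False by (subst zero_less_power2) simp
  ultimately show ?thesis by (simp only: mult_le_cancel_right_pos)
qed

lemma col_estimate_second_moment_le:
  fixes dev :: "'d::finite \<Rightarrow> 'n::finite" and A :: "real ^ 'd ^ 's::finite"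
  assumes "surj dev"
  shows "measure_pmf.expectation (col_choice dev) (\<lambda>j. (norm (col_estimate dev A j v))\<^sup>2) \<le>
    real CARD('d) * (MAX i. lambda_max_on (coords dev i)
      (transpose (block_cols dev i A) ** block_cols dev i A)) * (norm v)\<^sup>2"
proof -
  let ?l = "\<lambda>i. lambda_max_on (coords dev i) (transpose (block_cols dev i A) ** block_cols dev i A)"
  have "(norm (transpose (block_cols dev i A) *v v))\<^sup>2 \<le> (MAX i. ?l i) * (norm v)\<^sup>2" for i
    by (rule order_trans[OF norm_transpose_block_cols_sq_le[OF assms]])
      (rule mult_right_mono, auto intro: Max_ge)
  then have "(\<Sum>i\<in>UNIV. card (coords dev i) * (norm (transpose (block_cols dev i A) *v v))\<^sup>2) \<le>
      (\<Sum>i\<in>UNIV. card (coords dev i) * ((MAX i. ?l i) * (norm v)\<^sup>2))"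
    by (intro sum_mono mult_left_mono) auto
  also have "\<dots> = real CARD('d) * (MAX i. ?l i) * (norm v)\<^sup>2"
    unfolding sum_distrib_right[symmetric] of_nat_sum[symmetric] sum_card_coords by simp
  finally show ?thesis unfolding expectation_col_estimate_sq[OF assms] .
qed

text \<open>Each device is bounded through the full matrix \<open>A\<close>, and the blocks of
  \<open>v\<close> are orthogonal, so the bounds add up to one copy instead of one per device. The
  weights 1 and \<open>CARD('s) - 1\<close> then give the factor.\<close>

lemma row_estimate_second_moment_le:
  fixes dev :: "'d::finite \<Rightarrow> 'n::finite" and A :: "real ^ 'd ^ 's::finite"
  shows "measure_pmf.expectation row_choice (\<lambda>c. (norm (row_estimate dev A c v))\<^sup>2) \<le>
    real CARD('s) * lambda_max (transpose A ** A) * (norm v)\<^sup>2"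
proof -
  let ?l = "lambda_max (transpose A ** A)"
  have "(\<Sum>i\<in>UNIV. (norm (A *v block dev i v))\<^sup>2) \<le> (\<Sum>i\<in>UNIV. ?l * (norm (block dev i v))\<^sup>2)"
    by (intro sum_mono norm_matrix_vector_sq_le)
  also have "\<dots> = ?l * (norm v)\<^sup>2"
    by (simp only: sum_distrib_left[symmetric] sum_norm_block_sq)
  finally have "(real CARD('s) - 1) * (\<Sum>i\<in>UNIV. (norm (A *v block dev i v))\<^sup>2)
      \<le> (real CARD('s) - 1) * (?l * (norm v)\<^sup>2)"
    by (rule mult_left_mono) simp
  then show ?thesis
    unfolding expectation_row_estimate_sq using norm_matrix_vector_sq_le[of A v]
    by (simp add: algebra_simps)
qed

lemma grad_block:
  fixes dev :: "'d::finite \<Rightarrow> 'n::finite" and f :: "real ^ 'd \<Rightarrow> real"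
  assumes f_block: "\<And>v. f v = f (block dev i v)" and "smooth c f"
  shows "block dev i (grad f v) = grad f v"
proof -
  let ?g = "grad f (block dev i v)"
  have lin: "bounded_linear (block dev i)"
    unfolding linear_conv_bounded_linear[symmetric]
    by (rule linearI) (auto simp: vec_eq_iff block_nth)
  have "(f has_derivative (\<lambda>h. h \<bullet> ?g)) (at (block dev i v))"
    using smooth_gderiv[OF assms(2)] by (simp only: gderiv_def)
  from has_derivative_compose[OF bounded_linear_imp_has_derivative[OF lin] this]
  have "((\<lambda>v. f (block dev i v)) has_derivative (\<lambda>h. block dev i h \<bullet> ?g)) (at v)" .
  \<comment> \<open>\<open>f\<close> equals its composition with the block projection, which is
    linear and self-adjoint, so the chain rule puts the projection in front of the gradient.\<close>
  then have "GDERIV f v :> block dev i ?g"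
    unfolding gderiv_def f_block[symmetric] inner_block .
  then have "grad f v = block dev i ?g" by (rule grad_eqI)
  then show ?thesis by (simp add: block_idem)
qed

definition block_grad :: "('d::finite \<Rightarrow> 'n::finite) \<Rightarrow> ('n \<Rightarrow> real ^ 'd \<Rightarrow> real) \<Rightarrow> real ^ 'd \<Rightarrow> real ^ 'd" where
  "block_grad dev r x = (\<Sum>i\<in>UNIV. grad (r i) (block dev i x))"

text \<open>Gradients of different devices occupy orthogonal blocks, so squared norms add and the
  Lipschitz constant does not grow with the number of devices.\<close>

lemma norm_block_grad_diff_le:
  fixes dev :: "'d::finite \<Rightarrow> 'n::finite"
  assumes r_block: "\<And>i v. r i v = r i (block dev i v)" and r_smooth: "\<And>i. smooth c (r i)"
  shows "(norm (block_grad dev r x - block_grad dev r x'))\<^sup>2 \<le> c\<^sup>2 * (norm (x - x'))\<^sup>2"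
proof -
  let ?G = "\<lambda>i x. grad (r i) (block dev i x)"
  have gb: "block dev i (grad (r i) v) = grad (r i) v" for i v
    using grad_block[OF r_block r_smooth] .
  have other: "block dev i (?G k x) = (if k = i then ?G i x else 0)" for i k x
  proof (cases "k = i")
    case False
    then show ?thesis by (subst gb[symmetric]) (simp add: vec_eq_iff block_nth)
  qed (simp add: gb)
  have "block dev i (block_grad dev r x) = (\<Sum>k\<in>UNIV. block dev i (?G k x))" for i x
    by (simp add: vec_eq_iff block_nth block_grad_def)
  then have blk: "block dev i (block_grad dev r x) = ?G i x" for i x
    by (simp add: other)
  have "(norm (block_grad dev r x - block_grad dev r x'))\<^sup>2 =
      (\<Sum>i\<in>UNIV. (norm (block dev i (block_grad dev r x - block_grad dev r x')))\<^sup>2)"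
    by (rule sum_norm_block_sq[symmetric])
  also have "\<dots> = (\<Sum>i\<in>UNIV. (norm (?G i x - ?G i x'))\<^sup>2)"
    unfolding block_diff[symmetric] blk ..
  also have "\<dots> \<le> (\<Sum>i\<in>UNIV. c\<^sup>2 * (norm (block dev i (x - x')))\<^sup>2)"
  proof (rule sum_mono)
    fix i
    have "norm (?G i x - ?G i x') \<le> c * norm (block dev i (x - x'))"
      using r_smooth[of i] unfolding smooth_def block_diff[symmetric] by blast
    then show "(norm (?G i x - ?G i x'))\<^sup>2 \<le> c\<^sup>2 * (norm (block dev i (x - x')))\<^sup>2"
      unfolding power_mult_distrib[symmetric] by (rule power_mono) simp
  qed
  also have "\<dots> = c\<^sup>2 * (norm (x - x'))\<^sup>2"
    by (simp only: sum_distrib_left[symmetric] sum_norm_block_sq)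
  finally show ?thesis .
qed

section \<open>The Lagrangian and the vector form of the iteration\<close>

lemma lagrangian_eq:
  "lagrangian dev A l r x z y = l z + (\<Sum>i\<in>UNIV. r i (block dev i x)) + y \<bullet> (A *v x - z)"
  by (simp add: lagrangian_def sum_block_cols_mult_block)

text \<open>The right side pairs the saddle operator at the half point (gradients in
  \<open>x\<close> and \<open>z\<close>, negated gradient in \<open>y\<close>) with the
  displacement. Convexity handles \<open>r\<close> and \<open>l\<close>; the bilinear terms agree
  exactly.\<close>

lemma lagrangian_diff_le:
  fixes dev :: "'d::finite \<Rightarrow> 'n::finite"
  assumes r_block: "\<And>i v. r i v = r i (block dev i v)" and r_smooth: "\<And>i. smooth c (r i)"
    and r_convex: "\<And>i. convex_on UNIV (r i)"
    and l_smooth: "smooth c' l" and l_convex: "convex_on UNIV l"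
  shows "lagrangian dev A l r xh zh y - lagrangian dev A l r x z yh \<le>
    (transpose A *v yh + block_grad dev r xh) \<bullet> (xh - x) + (grad l zh - yh) \<bullet> (zh - z)
      + (zh - A *v xh) \<bullet> (yh - y)"
proof -
  have "r i (block dev i xh) - r i (block dev i x) \<le> grad (r i) (block dev i xh) \<bullet> (xh - x)" for i
  proof -
    have "r i (block dev i xh) - r i (block dev i x) \<le> grad (r i) (block dev i xh) \<bullet> (block dev i xh - block dev i x)"
      by (rule convex_gradient_inequality[OF r_convex smooth_gderiv[OF r_smooth]])
    also have "\<dots> = grad (r i) (block dev i xh) \<bullet> (xh - x)"
      unfolding block_diff inner_block[symmetric] by (simp only: grad_block[OF r_block r_smooth])
    finally show ?thesis .
  qed
  then have "(\<Sum>i\<in>UNIV. r i (block dev i xh)) - (\<Sum>i\<in>UNIV. r i (block dev i x)) \<le> block_grad dev r xh \<bullet> (xh - x)"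
    unfolding block_grad_def inner_sum_left sum_subtractf[symmetric] by (rule sum_mono)
  moreover have "l zh - l z \<le> grad l zh \<bullet> (zh - z)"
    by (rule convex_gradient_inequality[OF l_convex smooth_gderiv[OF l_smooth]])
  moreover have "(transpose A *v yh) \<bullet> (xh - x) = yh \<bullet> (A *v xh) - yh \<bullet> (A *v x)"
    by (simp only: inner_transpose_mult matrix_vector_mult_diff_distrib inner_diff_right)
  moreover have "(grad l zh - yh) \<bullet> (zh - z) = grad l zh \<bullet> (zh - z) - yh \<bullet> zh + yh \<bullet> z"
    by (simp add: inner_diff_left inner_diff_right)
  moreover have "(zh - A *v xh) \<bullet> (yh - y) = yh \<bullet> zh - y \<bullet> zh - yh \<bullet> (A *v xh) + y \<bullet> (A *v xh)"
    by (simp add: inner_diff_left inner_diff_right inner_commute)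
  ultimately show ?thesis
    unfolding lagrangian_eq inner_add_left inner_diff_right[of y] inner_diff_right[of yh "A *v x"] by linarith
qed

lemma sum_block_update:
  fixes dev :: "'d::finite \<Rightarrow> 'n::finite"
  shows "(\<Sum>i\<in>UNIV. \<tau> *\<^sub>R block dev i x + (1 - \<tau>) *\<^sub>R block dev i w
      - \<gamma> *\<^sub>R (c i + transpose (block_cols dev i A) *v u + grad (r i) (block dev i x'))) =
    \<tau> *\<^sub>R x + (1 - \<tau>) *\<^sub>R w - \<gamma> *\<^sub>R (sum c UNIV + transpose A *v u + block_grad dev r x')"
proof -
  have s: "(\<Sum>i\<in>UNIV. a *\<^sub>R f i) = a *\<^sub>R (\<Sum>i\<in>UNIV. f i)" for a and f :: "'n \<Rightarrow> real ^ 'd"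
    by (rule scaleR_sum_right[symmetric])
  show ?thesis
    unfolding sum.distrib sum_subtractf s sum_block sum_transpose_block_cols_mult block_grad_def ..
qed

lemma half_point_eq:
  fixes dev :: "'d::finite \<Rightarrow> 'n::finite"
  shows "half_point dev A l r \<gamma> \<tau> (x, z, y, w, u) =
    (\<tau> *\<^sub>R x + (1 - \<tau>) *\<^sub>R w - \<gamma> *\<^sub>R (transpose A *v u + block_grad dev r x),
     z - \<gamma> *\<^sub>R (grad l z - y),
     \<tau> *\<^sub>R y + (1 - \<tau>) *\<^sub>R u - \<gamma> *\<^sub>R (z - A *v w))"
proof -
  have "(\<Sum>i\<in>UNIV. \<tau> *\<^sub>R block dev i x + (1 - \<tau>) *\<^sub>R block dev i w
      - \<gamma> *\<^sub>R (transpose (block_cols dev i A) *v u + grad (r i) (block dev i x))) =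
    \<tau> *\<^sub>R x + (1 - \<tau>) *\<^sub>R w - \<gamma> *\<^sub>R (transpose A *v u + block_grad dev r x)"
    using sum_block_update[where c = "\<lambda>_. 0" and dev = dev and r = r and A = A and x = x and w = w
        and u = u and x' = x and \<gamma> = \<gamma> and \<tau> = \<tau>]
    by (simp only: sum.neutral_const add_0_left)
  moreover have "v + \<gamma> *\<^sub>R (A *v w - z) = v - \<gamma> *\<^sub>R (z - A *v w)" for v
    by (simp add: scaleR_diff_right)
  ultimately show ?thesis
    unfolding half_point_def prod.case by (simp only: sum_block_cols_mult_block)
qed

text \<open>Directions are split into sampled correction, half-step direction and increment, the
  shape of \<open>anchored_step\<close>. The \<open>y\<close>-update is an ascent step; the minus
  signs turn it into descent along the negated gradient.\<close>

lemma full_point_eq: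
  fixes dev :: "'d::finite \<Rightarrow> 'n::finite"
  shows "full_point dev A l r \<gamma> \<tau> c j flip (xh, zh, yh) (x, z, y, w, u) =
    (\<tau> *\<^sub>R x + (1 - \<tau>) *\<^sub>R w - \<gamma> *\<^sub>R (col_estimate dev A j (yh - u)
        + (transpose A *v u + block_grad dev r x) + (block_grad dev r xh - block_grad dev r x)),
     z - \<gamma> *\<^sub>R (grad l zh - yh),
     \<tau> *\<^sub>R y + (1 - \<tau>) *\<^sub>R u - \<gamma> *\<^sub>R (- row_estimate dev A c (xh - w) + (z - A *v w) + (zh - z)),
     if flip then x else w, if flip then y else u)"
proof -
  have "col_estimate dev A j (yh - u) + (transpose A *v u + block_grad dev r x) + (block_grad dev r xh - block_grad dev r x)
    = col_estimate dev A j (yh - u) + transpose A *v u + block_grad dev r xh"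
    by (simp del: transpose_matrix_vector)
  moreover have "v - \<gamma> *\<^sub>R (- row_estimate dev A c (xh - w) + (z - A *v w) + (zh - z)) =
      v + \<gamma> *\<^sub>R (row_estimate dev A c (xh - w) + A *v w - zh)" for v
    by (simp add: scaleR_diff_right scaleR_add_right)
  ultimately show ?thesis
    unfolding full_point_def prod.case sum_block_update col_estimate_def[symmetric]
    by (simp only: sum.distrib sum_block_cols_mult_block block_diff row_estimate_def[symmetric])
qed

subsection \<open>The descent inequality\<close>

lemma finite_set_pmf_step:
  fixes dev :: "'d::finite \<Rightarrow> 'n::finite" and A :: "real ^ 'd ^ 's::finite"
  shows "finite (set_pmf (step dev A l r \<gamma> \<tau> p st))"
  unfolding step_def by (auto simp: Let_def)

lemma fst_step:
  assumes "h \<in> fst ` set_pmf (step dev A l r \<gamma> \<tau> p st)"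
  shows "h = half_point dev A l r \<gamma> \<tau> st"
  using assms unfolding step_def by (auto simp: Let_def)

text \<open>The squared norm is additive over components, so the coin shared by \<open>w\<close> and
  \<open>u\<close> causes no correlation term. The target is a general five-tuple because it serves
  both as comparison point and as centre for the variance.\<close>

lemma expectation_step_sq_dist:
  fixes dev :: "'d::finite \<Rightarrow> 'n::finite" and A :: "real ^ 'd ^ 's::finite"
  assumes p: "0 \<le> p" "p \<le> 1" and h: "half_point dev A l r \<gamma> \<tau> (x, z, y, w, u) = (xh, zh, yh)"
  shows "measure_pmf.expectation (step dev A l r \<gamma> \<tau> p (x, z, y, w, u))
      (\<lambda>t. (norm (snd t - (q1, q2, q3, q4, q5)))\<^sup>2) =
    measure_pmf.expectation (col_choice dev) (\<lambda>j.
      (norm (\<tau> *\<^sub>R x + (1 - \<tau>) *\<^sub>R w - \<gamma> *\<^sub>R (col_estimate dev A j (yh - u)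
        + (transpose A *v u + block_grad dev r x) + (block_grad dev r xh - block_grad dev r x)) - q1))\<^sup>2)
    + (norm (z - \<gamma> *\<^sub>R (grad l zh - yh) - q2))\<^sup>2
    + measure_pmf.expectation row_choice (\<lambda>c.
      (norm (\<tau> *\<^sub>R y + (1 - \<tau>) *\<^sub>R u
        - \<gamma> *\<^sub>R (- row_estimate dev A c (xh - w) + (z - A *v w) + (zh - z)) - q3))\<^sup>2)
    + (p * (norm (x - q4))\<^sup>2 + (1 - p) * (norm (w - q4))\<^sup>2)
    + (p * (norm (y - q5))\<^sup>2 + (1 - p) * (norm (u - q5))\<^sup>2)"
proof -
  have [simp]: "integrable (measure_pmf (col_choice dev)) f" for f :: "_ \<Rightarrow> real"
    by (rule integrable_measure_pmf_finite) (rule finite)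
  have [simp]: "integrable (measure_pmf (row_choice :: ('n \<Rightarrow> 's) pmf)) f" for f :: "_ \<Rightarrow> real"
    by (rule integrable_measure_pmf_finite) (rule finite)
  have nsq: "(norm (a, b, c, d, e))\<^sup>2 =
      (norm a)\<^sup>2 + (norm b)\<^sup>2 + (norm c)\<^sup>2 + (norm d)\<^sup>2 + (norm e)\<^sup>2"
    for a d :: "real ^ 'd" and b c e :: "real ^ 's"
    by (simp add: norm_Pair)
  define X where "X j = \<tau> *\<^sub>R x + (1 - \<tau>) *\<^sub>R w - \<gamma> *\<^sub>R (col_estimate dev A j (yh - u)
        + (transpose A *v u + block_grad dev r x) + (block_grad dev r xh - block_grad dev r x))" for j
  define Y where "Y c = \<tau> *\<^sub>R y + (1 - \<tau>) *\<^sub>R u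
        - \<gamma> *\<^sub>R (- row_estimate dev A c (xh - w) + (z - A *v w) + (zh - z))" for c
  define Z where "Z = z - \<gamma> *\<^sub>R (grad l zh - yh)"
  have full: "full_point dev A l r \<gamma> \<tau> c j flip (xh, zh, yh) (x, z, y, w, u) =
      (X j, Z, Y c, if flip then x else w, if flip then y else u)" for c j flip
    unfolding full_point_eq X_def Y_def Z_def ..
  let ?e = "(p * (norm (x - q4))\<^sup>2 + (1 - p) * (norm (w - q4))\<^sup>2)
    + (p * (norm (y - q5))\<^sup>2 + (1 - p) * (norm (u - q5))\<^sup>2)"
  have E: "measure_pmf.expectation (step dev A l r \<gamma> \<tau> p (x, z, y, w, u)) f =
      measure_pmf.expectation row_choice (\<lambda>c. measure_pmf.expectation (col_choice dev) (\<lambda>j.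
        p * f ((xh, zh, yh), (X j, Z, Y c, x, y)) + (1 - p) * f ((xh, zh, yh), (X j, Z, Y c, w, u))))"
    for f :: "_ \<Rightarrow> real"
    unfolding step_def Let_def h full using p
    by (simp add: expectation_bind_pmf integral_bernoulli_pmf mult.commute)
  have "measure_pmf.expectation (step dev A l r \<gamma> \<tau> p (x, z, y, w, u))
      (\<lambda>t. (norm (snd t - (q1, q2, q3, q4, q5)))\<^sup>2) =
    measure_pmf.expectation row_choice (\<lambda>c. measure_pmf.expectation (col_choice dev) (\<lambda>j.
      (norm (X j - q1))\<^sup>2 + ((norm (Z - q2))\<^sup>2 + (norm (Y c - q3))\<^sup>2 + ?e)))"
    unfolding E by (intro Bochner_Integration.integral_cong refl) (simp only: snd_conv diff_Pair nsq, algebra)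
  then show ?thesis
    unfolding X_def[symmetric] Y_def[symmetric] Z_def[symmetric] by simp
qed

text \<open>
  The comparison point is used both for the iterate and for the anchor.  As the anchor is refreshed
  with the old iterate \<open>(x, y)\<close> with probability \<open>p = 1 - \<tau>\<close>, the weights \<open>\<tau>\<close>, \<open>1 - \<tau>\<close> of the update
  and \<open>p\<close>, \<open>1 - p\<close> of the coin add up to \<open>1\<close> for iterate and anchor alike.
\<close>

lemma step_descent:
  fixes dev :: "'d::finite \<Rightarrow> 'n::finite" and A :: "real ^ 'd ^ 's::finite"
  assumes surj: "surj dev"
    and r_block: "\<And>i v. r i v = r i (block dev i v)" and r_smooth: "\<And>i. smooth Lr (r i)"
    and r_convex: "\<And>i. convex_on UNIV (r i)"
    and l_smooth: "smooth Ll l" and l_convex: "convex_on UNIV l"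
    and p: "0 < p" "p \<le> 9 / 10" and tau: "\<tau> = 1 - p"
    and \<gamma>: "0 < \<gamma>" "\<gamma> \<le> 1 / 4" "\<gamma> * Lr \<le> 1 / 4" "\<gamma> * Ll \<le> 1 / 4"
    and \<gamma>_row: "\<gamma>\<^sup>2 * (real CARD('s) * lambda_max (transpose A ** A)) \<le> p / 16"
    and \<gamma>_col: "\<gamma>\<^sup>2 * (real CARD('d) * (MAX i. lambda_max_on (coords dev i)
      (transpose (block_cols dev i A) ** block_cols dev i A))) \<le> p / 16"
    and h: "half_point dev A l r \<gamma> \<tau> (x, z, y, w, u) = (xh, zh, yh)"
  defines "\<kappa> \<equiv> step dev A l r \<gamma> \<tau> p (x, z, y, w, u)"
  shows "measure_pmf.expectation \<kappa> (\<lambda>t. (norm (snd t - (qx, qz, qy, qx, qy)))\<^sup>2)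
      + 1 / 5 * measure_pmf.expectation \<kappa> (\<lambda>t. (norm (snd t - measure_pmf.expectation \<kappa> snd))\<^sup>2)
      + 2 * \<gamma> * (lagrangian dev A l r xh zh qy - lagrangian dev A l r qx qz yh)
    \<le> (norm ((x, z, y, w, u) - (qx, qz, qy, qx, qy)))\<^sup>2"
proof -
  have p01: "0 \<le> p" "p \<le> 1" using p by auto
  have tau': "1 - \<tau> = p" by (simp add: tau)
  have [simp]: "finite (set_pmf (col_choice dev))" "finite (set_pmf (row_choice :: ('n \<Rightarrow> 's) pmf))"
    by (rule finite)+
  let ?G = "block_grad dev r"
  let ?bx = "transpose A *v u + ?G x" and ?dx = "?G xh - ?G x"
  let ?by = "z - A *v w" and ?dy = "zh - z"
  let ?X = "\<lambda>j. \<tau> *\<^sub>R x + (1 - \<tau>) *\<^sub>R w - \<gamma> *\<^sub>R (col_estimate dev A j (yh - u) + ?bx + ?dx)"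
  let ?Y = "\<lambda>c. \<tau> *\<^sub>R y + (1 - \<tau>) *\<^sub>R u - \<gamma> *\<^sub>R (- row_estimate dev A c (xh - w) + ?by + ?dy)"
  let ?Z = "z - \<gamma> *\<^sub>R (grad l zh - yh)"
  let ?E\<xi> = "measure_pmf.expectation (col_choice dev) (\<lambda>j. (norm (col_estimate dev A j (yh - u)))\<^sup>2)"
  let ?E\<eta> = "measure_pmf.expectation row_choice (\<lambda>c. (norm (row_estimate dev A c (xh - w)))\<^sup>2)"
  define a where "a = (norm (xh - x))\<^sup>2"
  define b where "b = (norm (xh - w))\<^sup>2"
  define a' where "a' = (norm (yh - y))\<^sup>2"
  define b' where "b' = (norm (yh - u))\<^sup>2"
  define e where "e = (norm (zh - z))\<^sup>2"
  note sq_defs = a_def b_def a'_def b'_def e_def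
  have xh: "xh = \<tau> *\<^sub>R x + (1 - \<tau>) *\<^sub>R w - \<gamma> *\<^sub>R ?bx"
    and zh: "zh = z - \<gamma> *\<^sub>R (grad l z - y)"
    and yh: "yh = \<tau> *\<^sub>R y + (1 - \<tau>) *\<^sub>R u - \<gamma> *\<^sub>R ?by"
    using h unfolding half_point_eq by auto
  have E\<xi>: "\<gamma>\<^sup>2 * ?E\<xi> \<le> p / 16 * b'"
  proof -
    have "\<gamma>\<^sup>2 * ?E\<xi> \<le> \<gamma>\<^sup>2 * (real CARD('d) * (MAX i. lambda_max_on (coords dev i)
      (transpose (block_cols dev i A) ** block_cols dev i A)) * b')"
      unfolding b'_def by (rule mult_left_mono[OF col_estimate_second_moment_le[OF surj]]) simp
    also have "\<dots> \<le> p / 16 * b'"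
      using mult_right_mono[OF \<gamma>_col, of b'] by (simp add: b'_def mult_ac)
    finally show ?thesis .
  qed
  have E\<eta>: "\<gamma>\<^sup>2 * ?E\<eta> \<le> p / 16 * b"
  proof -
    have "\<gamma>\<^sup>2 * ?E\<eta> \<le> \<gamma>\<^sup>2 * (real CARD('s) * lambda_max (transpose A ** A) * b)"
      unfolding b_def by (rule mult_left_mono[OF row_estimate_second_moment_le]) simp
    also have "\<dots> \<le> p / 16 * b"
      using mult_right_mono[OF \<gamma>_row, of b] by (simp add: b_def mult_ac)
    finally show ?thesis .
  qed
  have quarter: "\<gamma>\<^sup>2 * s \<le> 1 / 16 * v" if "s \<le> c\<^sup>2 * v" "\<gamma> * c \<le> 1 / 4" "0 \<le> c" "0 \<le> v" for s c v
  proof -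
    have "(\<gamma> * c)\<^sup>2 \<le> (1 / 4)\<^sup>2"
      using that(2,3) \<gamma>(1) by (intro power_mono) auto
    then have "(\<gamma> * c)\<^sup>2 * v \<le> 1 / 16 * v"
      using that(4) by (intro mult_right_mono) (auto simp: power2_eq_square)
    moreover have "\<gamma>\<^sup>2 * s \<le> \<gamma>\<^sup>2 * (c\<^sup>2 * v)" using that(1) by (intro mult_left_mono) auto
    ultimately show ?thesis by (simp add: power_mult_distrib)
  qed
  have Lpos: "0 \<le> Lr" "0 \<le> Ll" using r_smooth l_smooth unfolding smooth_def by (auto intro: less_imp_le)
  have dx: "\<gamma>\<^sup>2 * (norm ?dx)\<^sup>2 \<le> 1 / 16 * a"
    unfolding a_def by (rule quarter[OF norm_block_grad_diff_le[OF r_block r_smooth] \<gamma>(3) Lpos(1)]) simp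
  have dy: "\<gamma>\<^sup>2 * (norm ?dy)\<^sup>2 \<le> 1 / 16 * e"
    unfolding e_def by (rule quarter[of _ 1]) (use \<gamma>(2) in auto)
  have dz: "\<gamma>\<^sup>2 * (norm (- (yh - y)))\<^sup>2 \<le> 1 / 16 * a'"
    unfolding a'_def norm_minus_cancel by (rule quarter[of _ 1]) (use \<gamma>(2) in auto)
  have dl: "\<gamma>\<^sup>2 * (norm (grad l zh - grad l z))\<^sup>2 \<le> 1 / 16 * e"
    unfolding e_def
  proof (rule quarter[OF _ \<gamma>(4) Lpos(2)])
    have "norm (grad l zh - grad l z) \<le> Ll * norm (zh - z)"
      using l_smooth unfolding smooth_def by blast
    then show "(norm (grad l zh - grad l z))\<^sup>2 \<le> Ll\<^sup>2 * (norm (zh - z))\<^sup>2"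
      unfolding power_mult_distrib[symmetric] by (rule power_mono) simp
  qed simp
  have 1: "measure_pmf.expectation (col_choice dev) (\<lambda>j. (norm (?X j - qx))\<^sup>2) \<le>
      \<tau> * (norm (x - qx))\<^sup>2 + p * (norm (w - qx))\<^sup>2 - \<tau> * a - p * b
      - 2 * \<gamma> * ((transpose A *v yh + ?G xh) \<bullet> (xh - qx)) + 5 * (p / 16 * b') + 5 / 4 * (1 / 16 * a)"
  proof -
    have "measure_pmf.expectation (col_choice dev) (\<lambda>j. col_estimate dev A j (yh - u)) + ?bx + ?dx =
        transpose A *v yh + ?G xh"
      unfolding expectation_col_estimate[OF surj] matrix_vector_mult_diff_distrib
      by (simp del: transpose_matrix_vector)
    note mean = this
    have "\<gamma>\<^sup>2 * (5 * ?E\<xi> + 5 / 4 * (norm ?dx)\<^sup>2) \<le> 5 * (p / 16 * b') + 5 / 4 * (1 / 16 * a)"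
      using E\<xi> dx by (simp add: distrib_left)
    then show ?thesis
      using anchored_step[OF _ xh, of "col_choice dev" "\<lambda>j. col_estimate dev A j (yh - u)" ?dx qx]
      unfolding mean a_def[symmetric] b_def[symmetric] tau' by simp
  qed
  have 2: "measure_pmf.expectation row_choice (\<lambda>c. (norm (?Y c - qy))\<^sup>2) \<le>
      \<tau> * (norm (y - qy))\<^sup>2 + p * (norm (u - qy))\<^sup>2 - \<tau> * a' - p * b'
      - 2 * \<gamma> * ((zh - A *v xh) \<bullet> (yh - qy)) + 5 * (p / 16 * b) + 5 / 4 * (1 / 16 * e)"
  proof -
    have "measure_pmf.expectation row_choice (\<lambda>c. - row_estimate dev A c (xh - w)) + ?by + ?dy = zh - A *v xh"
      by (simp add: expectation_row_estimate matrix_vector_mult_diff_distrib)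
    note mean = this
    have "\<gamma>\<^sup>2 * (5 * ?E\<eta> + 5 / 4 * (norm ?dy)\<^sup>2) \<le> 5 * (p / 16 * b) + 5 / 4 * (1 / 16 * e)"
      using E\<eta> dy by (simp add: distrib_left)
    then show ?thesis
      using anchored_step[OF _ yh, of row_choice "\<lambda>c. - row_estimate dev A c (xh - w)" ?dy qy]
      unfolding mean norm_minus_cancel a'_def[symmetric] b'_def[symmetric] tau' by simp
  qed
  have 3: "(norm (?Z - qz))\<^sup>2 \<le> (norm (z - qz))\<^sup>2 - e - 2 * \<gamma> * ((grad l zh - yh) \<bullet> (zh - qz))
      + 5 * (1 / 16 * e) + 5 / 4 * (1 / 16 * a')"
  proof -
    \<comment> \<open>The \<open>z\<close>-update has no anchor and fits the scheme with weight 1 on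
      the iterate. Young's large weight goes to the increment of \<open>grad l\<close>, charged to
      the ample \<open>e\<close>; the small one goes to the increment of \<open>y\<close>, charged
      to the scarce \<open>\<tau> * a'\<close>.\<close>
    have zh': "zh = 1 *\<^sub>R z + (1 - 1) *\<^sub>R z - \<gamma> *\<^sub>R (grad l z - y)" using zh by simp
    have sum: "grad l zh - grad l z + (grad l z - y) + - (yh - y) = grad l zh - yh" by simp
    have "\<gamma>\<^sup>2 * (norm (grad l zh - grad l z + - (yh - y)))\<^sup>2 \<le>
        \<gamma>\<^sup>2 * (5 * (norm (grad l zh - grad l z))\<^sup>2 + 5 / 4 * (norm (- (yh - y)))\<^sup>2)"
      by (intro mult_left_mono norm_add_sq_le) simp
    also have "\<dots> \<le> 5 * (1 / 16 * e) + 5 / 4 * (1 / 16 * a')"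
      using dl dz by (simp add: distrib_left)
    finally show ?thesis
      using anchored_step_pointwise[OF zh', of "grad l zh - grad l z" "- (yh - y)" qz]
      unfolding sum e_def[symmetric] by simp
  qed
  have E1: "measure_pmf.expectation \<kappa> (\<lambda>t. (norm (snd t - (qx, qz, qy, qx, qy)))\<^sup>2) =
     measure_pmf.expectation (col_choice dev) (\<lambda>j. (norm (?X j - qx))\<^sup>2) + (norm (?Z - qz))\<^sup>2
     + measure_pmf.expectation row_choice (\<lambda>c. (norm (?Y c - qy))\<^sup>2)
     + (p * (norm (x - qx))\<^sup>2 + (1 - p) * (norm (w - qx))\<^sup>2)
     + (p * (norm (y - qy))\<^sup>2 + (1 - p) * (norm (u - qy))\<^sup>2)"
    unfolding \<kappa>_def by (rule expectation_step_sq_dist[OF p01 h])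
  \<comment> \<open>Any centre bounds the variance from above. This one drops the sampled
    corrections, so that the deviations of iterate and dual variable are exactly \<gamma> times
    those corrections; for the anchors it is the exact mean of the coin.\<close>
  let ?mx = "\<tau> *\<^sub>R x + (1 - \<tau>) *\<^sub>R w - \<gamma> *\<^sub>R (?bx + ?dx)"
  let ?my = "\<tau> *\<^sub>R y + (1 - \<tau>) *\<^sub>R u - \<gamma> *\<^sub>R (?by + ?dy)"
  let ?mw = "p *\<^sub>R x + (1 - p) *\<^sub>R w"
  let ?mu = "p *\<^sub>R y + (1 - p) *\<^sub>R u"
  have coin: "p * (norm (f - (p *\<^sub>R f + (1 - p) *\<^sub>R g)))\<^sup>2 + (1 - p) * (norm (g - (p *\<^sub>R f + (1 - p) *\<^sub>R g)))\<^sup>2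
      = \<tau> * (1 - \<tau>) * (norm (f - g))\<^sup>2" for f g :: "real ^ 'k::finite"
  proof -
    have "f - (p *\<^sub>R f + (1 - p) *\<^sub>R g) = (1 - p) *\<^sub>R (f - g)"
      and "g - (p *\<^sub>R f + (1 - p) *\<^sub>R g) = - p *\<^sub>R (f - g)"
      by (simp_all add: scaleR_diff_right scaleR_diff_left)
    then show ?thesis
      by (simp add: tau power_mult_distrib) (simp add: power2_eq_square algebra_simps)
  qed
  have "measure_pmf.expectation \<kappa> (\<lambda>t. (norm (snd t - measure_pmf.expectation \<kappa> snd))\<^sup>2) \<le>
      measure_pmf.expectation \<kappa> (\<lambda>t. (norm (snd t - (?mx, ?Z, ?my, ?mw, ?mu)))\<^sup>2)"
    by (rule variance_le_second_moment) (simp add: \<kappa>_def finite_set_pmf_step)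
  also have "\<dots> = measure_pmf.expectation (col_choice dev) (\<lambda>j. (norm (?X j - ?mx))\<^sup>2)
     + (norm (?Z - ?Z))\<^sup>2 + measure_pmf.expectation row_choice (\<lambda>c. (norm (?Y c - ?my))\<^sup>2)
     + (p * (norm (x - ?mw))\<^sup>2 + (1 - p) * (norm (w - ?mw))\<^sup>2)
     + (p * (norm (y - ?mu))\<^sup>2 + (1 - p) * (norm (u - ?mu))\<^sup>2)"
    unfolding \<kappa>_def by (rule expectation_step_sq_dist[OF p01 h])
  also have "\<dots> = \<gamma>\<^sup>2 * ?E\<xi> + \<gamma>\<^sup>2 * ?E\<eta> + \<tau> * (1 - \<tau>) * (norm (x - w))\<^sup>2 + \<tau> * (1 - \<tau>) * (norm (y - u))\<^sup>2"
  proof -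
    have n: "(norm (v - \<gamma> *\<^sub>R (f + g + k) - (v - \<gamma> *\<^sub>R (g + k))))\<^sup>2 = \<gamma>\<^sup>2 * (norm f)\<^sup>2"
      for v f g k :: "real ^ 'k::finite"
    proof -
      have "v - \<gamma> *\<^sub>R (f + g + k) - (v - \<gamma> *\<^sub>R (g + k)) = - (\<gamma> *\<^sub>R f)" by (simp add: scaleR_add_right)
      then show ?thesis by (simp add: power_mult_distrib)
    qed
    show ?thesis unfolding n coin by simp
  qed
  also have "\<dots> \<le> p / 16 * b' + p / 16 * b + (\<tau> * a + p * b) + (\<tau> * a' + p * b')"
    using E\<xi> E\<eta> anchor_spread_le[of \<tau> x w xh] anchor_spread_le[of \<tau> y u yh]
    unfolding sq_defs by (simp add: tau)
  finally have 4: "measure_pmf.expectation \<kappa> (\<lambda>t. (norm (snd t - measure_pmf.expectation \<kappa> snd))\<^sup>2) \<le>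
      p / 16 * b' + p / 16 * b + (\<tau> * a + p * b) + (\<tau> * a' + p * b')" .
  have 5: "2 * \<gamma> * (lagrangian dev A l r xh zh qy - lagrangian dev A l r qx qz yh) \<le>
      2 * \<gamma> * ((transpose A *v yh + ?G xh) \<bullet> (xh - qx) + (grad l zh - yh) \<bullet> (zh - qz)
        + (zh - A *v xh) \<bullet> (yh - qy))"
    by (rule mult_left_mono[OF lagrangian_diff_le[OF r_block r_smooth r_convex l_smooth l_convex]])
      (use \<gamma>(1) in simp)
  have 6: "(norm ((x, z, y, w, u) - (qx, qz, qy, qx, qy)))\<^sup>2 =
      (norm (x - qx))\<^sup>2 + (norm (z - qz))\<^sup>2 + (norm (y - qy))\<^sup>2 + (norm (w - qx))\<^sup>2 + (norm (u - qy))\<^sup>2"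
    by (simp add: norm_Pair)
  have nonneg: "0 \<le> a" "0 \<le> a'" "0 \<le> e" "0 \<le> p * b" "0 \<le> p * b'" using p01 by (simp_all add: sq_defs)
  have \<tau>a: "1 / 10 * a \<le> \<tau> * a" "1 / 10 * a' \<le> \<tau> * a'"
    unfolding tau using p(2) nonneg by (intro mult_right_mono; simp)+
  have tp: "\<tau> * v + p * v = v" "p * v + (1 - p) * v = v" for v by (simp_all add: tau algebra_simps)
  \<comment> \<open>For \<open>p * b\<close> and \<open>p * b'\<close> the budget is 5/16 (Young)
    plus 1/5 + 1/80 (variance) against 1; for \<open>e\<close> it is 5/16 + 5/64 against 1.\<close>
  show ?thesis
    using 1 2 3 4 5 nonneg \<tau>a tp(1)[of "(norm (x - qx))\<^sup>2"] tp(1)[of "(norm (y - qy))\<^sup>2"]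
      tp(2)[of "(norm (w - qx))\<^sup>2"] tp(2)[of "(norm (u - qy))\<^sup>2"]
    unfolding E1 6 distrib_left[of "2 * \<gamma>"] by linarith
qed

subsection \<open>From the averaged iterates to the gap\<close>

text \<open>The reciprocal of a minimum is the largest of the reciprocals, here estimated by their
  sum. A vanishing \<open>q\<close> is absent from the minimum, but then its bound is
  trivial.\<close>

lemma stepsize_bounds:
  fixes dev :: "'d::finite \<Rightarrow> 'n::finite" and A :: "real ^ 'd ^ 's::finite"
  assumes surj: "surj dev" and L: "0 < Lr" "0 < Ll" and p: "0 < p" and tau: "\<tau> = 1 - p"
    and gamma: "\<gamma> = stepsize dev A Lr Ll \<tau>"
  defines "q1 \<equiv> real CARD('s) * lambda_max (transpose A ** A)"
    and "q2 \<equiv> real CARD('d) * (MAX i. lambda_max_on (coords dev i)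
          (transpose (block_cols dev i A) ** block_cols dev i A))"
  shows "0 < \<gamma>" "\<gamma> \<le> 1 / 4" "\<gamma> * Lr \<le> 1 / 4" "\<gamma> * Ll \<le> 1 / 4"
    "\<gamma>\<^sup>2 * q1 \<le> p / 16" "\<gamma>\<^sup>2 * q2 \<le> p / 16"
    "1 / \<gamma> \<le> 4 * (1 + sqrt (q1 / p) + sqrt (q2 / p) + Ll + Lr)"
proof -
  define F where "F = {1, 1 / Lr, 1 / Ll} \<union> {sqrt ((1 - \<tau>) / q) | q. q \<noteq> 0 \<and> q \<in> {q1, q2}}"
  have \<gamma>: "\<gamma> = 1 / 4 * Min F"
    unfolding gamma stepsize_def F_def q1_def q2_def ..
  have "F \<subseteq> {1, 1 / Lr, 1 / Ll} \<union> (\<lambda>q. sqrt ((1 - \<tau>) / q)) ` {q1, q2}"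
    unfolding F_def by blast
  then have fin: "finite F" by (rule finite_subset) simp
  have ne: "F \<noteq> {}" by (simp add: F_def)
  have q1: "0 \<le> q1"
    unfolding q1_def by (intro mult_nonneg_nonneg lambda_max_on_gram(2)) auto
  have "0 \<le> lambda_max_on (coords dev i) (transpose (block_cols dev i A) ** block_cols dev i A)" for i
    by (rule lambda_max_on_gram(2)) (use surj in \<open>auto simp: coords_def block_cols_def surj_def, metis\<close>)
  then have "0 \<le> (MAX i. lambda_max_on (coords dev i) (transpose (block_cols dev i A) ** block_cols dev i A))"
    by (subst Max_ge_iff) auto
  then have q2: "0 \<le> q2" unfolding q2_def by simp
  have "0 < m" if "m \<in> F" for m
    using that L p q1 q2 unfolding F_def tau by auto
  then have "0 < Min F" using fin ne by simp
  then show pos: "0 < \<gamma>" by (simp add: \<gamma>)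
  have le: "4 * \<gamma> \<le> m" if "m \<in> F" for m
    using that fin by (simp add: \<gamma>)
  show "\<gamma> \<le> 1 / 4" using le[of 1] by (simp add: F_def)
  show "\<gamma> * Lr \<le> 1 / 4" using le[of "1 / Lr"] L by (simp add: F_def field_simps)
  show "\<gamma> * Ll \<le> 1 / 4" using le[of "1 / Ll"] L by (simp add: F_def field_simps)
  have sq: "\<gamma>\<^sup>2 * q \<le> p / 16" if "q = q1 \<or> q = q2" "0 \<le> q" for q
  proof (cases "q = 0")
    case False
    then have "4 * \<gamma> \<le> sqrt (p / q)" using that by (intro le) (auto simp: F_def tau)
    then have "(4 * \<gamma>)\<^sup>2 \<le> (sqrt (p / q))\<^sup>2" using pos by (intro power_mono) auto
    also have "\<dots> = p / q" using p that by simp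
    finally show ?thesis using False that by (simp add: field_simps)
  qed (use p in simp)
  show "\<gamma>\<^sup>2 * q1 \<le> p / 16" "\<gamma>\<^sup>2 * q2 \<le> p / 16" using sq q1 q2 by auto
  have s: "0 \<le> sqrt (q1 / p)" "0 \<le> sqrt (q2 / p)" using q1 q2 p by auto
  have "1 / m \<le> 1 + sqrt (q1 / p) + sqrt (q2 / p) + Ll + Lr" if "m \<in> F" for m
  proof -
    have "1 / m \<in> {1, Lr, Ll, sqrt (q1 / p), sqrt (q2 / p)}"
      using that unfolding F_def tau by (auto simp: real_sqrt_divide)
    then show ?thesis using s L by auto
  qed
  from this[OF Min_in[OF fin ne]]
  show "1 / \<gamma> \<le> 4 * (1 + sqrt (q1 / p) + sqrt (q2 / p) + Ll + Lr)"
    by (simp add: \<gamma>)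
qed

section \<open>Averages and Jensen's inequality\<close>

lemma avg_eq_sum: "avg f hs = (1 / real (length hs)) *\<^sub>R (\<Sum>k<length hs. f (hs ! k))"
  by (simp add: avg_def sum_list_sum_nth atLeast0LessThan)

lemma convex_on_avg_le:
  assumes "convex_on UNIV f" "hs \<noteq> []"
  shows "f (avg \<phi> hs) \<le> avg (\<lambda>h. f (\<phi> h)) hs"
  using convex_on_sum[of "{..<length hs}" UNIV f "\<lambda>_. 1 / real (length hs)" "\<lambda>k. \<phi> (hs ! k)"] assms
  by (simp add: avg_eq_sum scaleR_sum_right sum_distrib_left lessThan_empty_iff)

lemma linear_avg:
  assumes "linear f"
  shows "f (avg \<phi> hs) = avg (\<lambda>h. f (\<phi> h)) hs"
  unfolding avg_eq_sum linear_scale[OF assms] linear_sum[OF assms] ..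

lemma avg_add: "avg (\<lambda>h. f h + g h) hs = avg f hs + avg g hs"
  by (simp add: avg_eq_sum sum.distrib scaleR_add_right)

lemma avg_diff: "avg (\<lambda>h. f h - g h) hs = avg f hs - avg g hs"
  by (simp add: avg_eq_sum sum_subtractf scaleR_diff_right)

lemma avg_sum: "avg (\<lambda>h. \<Sum>i\<in>I. f i h) hs = (\<Sum>i\<in>I. avg (f i) hs)"
  unfolding avg_eq_sum by (subst sum.swap) (simp add: scaleR_sum_right)

lemma avg_const: "hs \<noteq> [] \<Longrightarrow> avg (\<lambda>_. c) hs = c"
  by (simp add: avg_eq_sum sum_constant_scaleR)

text \<open>The Lagrangian is convex in \<open>(x, z)\<close>, where Jensen's inequality applies,
  and affine in \<open>y\<close>, where averaging is exact. As \<open>M\<close> is uniform in the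
  comparison point, supremum and infimum can be taken afterwards.\<close>

lemma gap_avg_le:
  fixes dev :: "'d::finite \<Rightarrow> 'n::finite" and A :: "real ^ 'd ^ 's::finite"
    and hs :: "('d, 's) half list"
  assumes r_block: "\<And>i v. r i v = r i (block dev i v)" and r_convex: "\<And>i. convex_on UNIV (r i)"
    and l_convex: "convex_on UNIV l" and hs: "hs \<noteq> []"
    and ne: "X \<noteq> {}" "Z \<noteq> {}" "Y \<noteq> {}"
    and M: "\<And>x z y. x \<in> X \<Longrightarrow> z \<in> Z \<Longrightarrow> y \<in> Y \<Longrightarrow>
      (\<Sum>(xh, zh, yh)\<leftarrow>hs. lagrangian dev A l r xh zh y - lagrangian dev A l r x z yh) \<le> M"
  shows "gap dev A l r X Z Y (avg (\<lambda>(xh, zh, yh). xh) hs) (avg (\<lambda>(xh, zh, yh). zh) hs)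
      (avg (\<lambda>(xh, zh, yh). yh) hs) \<le> M / real (length hs)"
proof -
  let ?x = "avg (\<lambda>(xh, zh, yh). xh) hs" and ?z = "avg (\<lambda>(xh, zh, yh). zh) hs"
    and ?y = "avg (\<lambda>(xh, zh, yh). yh) hs"
  have le: "lagrangian dev A l r ?x ?z y - lagrangian dev A l r x z ?y \<le> M / real (length hs)"
    if in': "x \<in> X" "z \<in> Z" "y \<in> Y" for x z y
  proof -
    have L: "lagrangian dev A l r x z y = l z + (\<Sum>i\<in>UNIV. r i x) + y \<bullet> (A *v x - z)" for x z y
      unfolding lagrangian_eq r_block[symmetric] ..
    have "l ?z \<le> avg (\<lambda>(xh, zh, yh). l zh) hs"
      using convex_on_avg_le[OF l_convex hs, of "\<lambda>(xh, zh, yh). zh"] by (simp add: case_prod_unfold)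
    moreover have "(\<Sum>i\<in>UNIV. r i ?x) \<le> avg (\<lambda>(xh, zh, yh). \<Sum>i\<in>UNIV. r i xh) hs"
      unfolding case_prod_unfold avg_sum by (intro sum_mono convex_on_avg_le r_convex hs)
    moreover have "y \<bullet> (A *v ?x - ?z) = avg (\<lambda>(xh, zh, yh). y \<bullet> (A *v xh - zh)) hs"
    proof -
      have "A *v ?x - ?z = avg (\<lambda>(xh, zh, yh). A *v xh - zh) hs"
        unfolding case_prod_unfold avg_diff by (simp add: linear_avg[OF matrix_vector_mul_linear])
      then show ?thesis
        by (simp add: case_prod_unfold linear_avg[OF bounded_linear.linear[OF bounded_linear_inner_right]])
    qed
    ultimately have upper: "lagrangian dev A l r ?x ?z y \<le> avg (\<lambda>(xh, zh, yh). lagrangian dev A l r xh zh y) hs"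
      unfolding L case_prod_unfold avg_add by simp
    have "?y \<bullet> (A *v x - z) = avg (\<lambda>(xh, zh, yh). yh \<bullet> (A *v x - z)) hs"
      by (simp add: case_prod_unfold linear_avg[OF bounded_linear.linear[OF bounded_linear_inner_left]])
    then have "lagrangian dev A l r x z ?y = avg (\<lambda>(xh, zh, yh). lagrangian dev A l r x z yh) hs"
      unfolding L case_prod_unfold avg_add avg_const[OF hs] by simp
    then have "lagrangian dev A l r ?x ?z y - lagrangian dev A l r x z ?y \<le>
        avg (\<lambda>(xh, zh, yh). lagrangian dev A l r xh zh y - lagrangian dev A l r x z yh) hs"
      using upper unfolding case_prod_unfold avg_diff by simp
    also have "\<dots> \<le> M / real (length hs)"
      using M[OF in'] unfolding avg_def by (simp add: divide_right_mono)
    finally show ?thesis .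
  qed
  have "(SUP y\<in>Y. lagrangian dev A l r ?x ?z y) \<le>
      M / real (length hs) + (INF (x, z)\<in>X \<times> Z. lagrangian dev A l r x z ?y)"
  proof (rule cSUP_least[OF ne(3)])
    fix y assume y: "y \<in> Y"
    have "lagrangian dev A l r ?x ?z y - M / real (length hs) \<le>
        (INF (x, z)\<in>X \<times> Z. lagrangian dev A l r x z ?y)"
    proof (rule cINF_greatest)
      show "X \<times> Z \<noteq> {}" using ne by simp
      fix t assume "t \<in> X \<times> Z"
      then show "lagrangian dev A l r ?x ?z y - M / real (length hs) \<le>
          (case t of (x, z) \<Rightarrow> lagrangian dev A l r x z ?y)"
        using le[OF _ _ y] by (auto simp: algebra_simps)
    qed
    then show "lagrangian dev A l r ?x ?z y \<le>
      M / real (length hs) + (INF (x, z)\<in>X \<times> Z. lagrangian dev A l r x z ?y)" by simp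
  qed
  then show ?thesis unfolding gap_def by simp
qed

lemma diam2_upper:
  assumes "compact X" "compact Z" "compact Y" "x \<in> X" "z \<in> Z" "y \<in> Y"
  shows "(norm (x0 - x))\<^sup>2 + (norm (z0 - z))\<^sup>2 + (norm (y0 - y))\<^sup>2 \<le> diam2 X Z Y x0 z0 y0"
proof -
  let ?f = "\<lambda>(x, z, y). (norm (x0 - x))\<^sup>2 + (norm (z0 - z))\<^sup>2 + (norm (y0 - y))\<^sup>2"
  have "compact (X \<times> Z \<times> Y)" using assms by (intro compact_Times)
  moreover have "continuous_on (X \<times> Z \<times> Y) ?f"
    unfolding case_prod_unfold by (intro continuous_intros)
  ultimately have "bdd_above (?f ` (X \<times> Z \<times> Y))"
    by (intro bounded_imp_bdd_above compact_imp_bounded compact_continuous_image)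
  from cSUP_upper[OF _ this, of "(x, z, y)"] show ?thesis
    using assms by (simp add: diam2_def)
qed

text \<open>The step size yields the square root of a dimension, the rate is stated with the
  dimension itself.\<close>

lemma sqrt_mult_card_le:
  assumes "0 \<le> c" "0 < p" "1 \<le> k"
  shows "sqrt (k * c / p) \<le> k / sqrt p * sqrt c"
proof -
  have "sqrt k \<le> k" using assms(3) by (intro real_le_lsqrt) (auto simp: power2_eq_square)
  then have "sqrt k * (sqrt c / sqrt p) \<le> k * (sqrt c / sqrt p)"
    using assms by (intro mult_right_mono) auto
  then show ?thesis by (simp add: real_sqrt_mult real_sqrt_divide)
qed

text \<open>The decreasing potential contains the anchors, whose initial distance to the comparison
  point \<open>D2\<close> does not measure. So \<open>\<kappa>\<close> records their offset from
  \<open>(x0, y0)\<close> in units of \<open>D2\<close>; if they coincide,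
  \<open>\<kappa> = 0\<close> is admissible. \<open>surj dev\<close> says that every device has
  positive dimension, and \<open>1000 * (1 + \<kappa>)\<close> is the constant behind the order
  symbol.\<close>

theorem theorem6:
  fixes dev :: "'d::finite \<Rightarrow> 'n::finite"
    and A :: "real ^ 'd ^ 's::finite"
    and b :: "real ^ 's"
    and ell :: "real ^ 's \<Rightarrow> real ^ 's \<Rightarrow> real"
    and r :: "'n \<Rightarrow> real ^ 'd \<Rightarrow> real"
    and X :: "(real ^ 'd) set" and Z Y :: "(real ^ 's) set"
    and x0 w0 :: "real ^ 'd" and z0 y0 u0 :: "real ^ 's"
    and Ll Lr p \<tau> \<gamma> D2 \<kappa> :: real and K :: nat
  assumes dims_pos: "surj dev"
    and r_block: "\<And>i v. r i v = r i (block dev i v)"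
    and ell_smooth: "smooth Ll (\<lambda>z. ell z b)" and ell_convex: "convex_on UNIV (\<lambda>z. ell z b)"
    and r_smooth: "\<And>i. smooth Lr (r i)" and r_convex: "\<And>i. convex_on UNIV (r i)"
    and X: "compact X" "X \<noteq> {}" and Z: "compact Z" "Z \<noteq> {}" and Y: "compact Y" "Y \<noteq> {}"
    and p: "0 < p" "p \<le> 9 / 10"
    and tau: "\<tau> = 1 - p"
    and gamma: "\<gamma> = stepsize dev A Lr Ll \<tau>"
    and D2: "D2 = diam2 X Z Y x0 z0 y0"
    and anchor: "(norm (w0 - x0))\<^sup>2 + (norm (u0 - y0))\<^sup>2 \<le> \<kappa> * D2"
    and K: "K \<ge> 1"
  shows
    "measure_pmf.expectation
       (run dev A (\<lambda>z. ell z b) r \<gamma> \<tau> p (x0, z0, y0, w0, u0) K)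
       (\<lambda>(hs, _). gap dev A (\<lambda>z. ell z b) r X Z Y
          (avg (\<lambda>(xh, zh, yh). xh) hs) (avg (\<lambda>(xh, zh, yh). zh) hs) (avg (\<lambda>(xh, zh, yh). yh) hs))
     \<le> 1000 * (1 + \<kappa>) *
       ((1 + real CARD('s) / sqrt p * sqrt (lambda_max (transpose A ** A))
           + real CARD('d) / sqrt p *
               (MAX i. sqrt (lambda_max (block_cols dev i A ** transpose (block_cols dev i A))))
           + Ll + Lr) * (D2 / real K))"
proof -
  let ?l = "\<lambda>z. ell z b"
  let ?e0 = "(x0, z0, y0, w0, u0)"
  let ?L = "lagrangian dev A ?l r"
  let ?gap = "\<lambda>hs. gap dev A ?l r X Z Y
     (avg (\<lambda>(xh, zh, yh). xh) hs) (avg (\<lambda>(xh, zh, yh). zh) hs) (avg (\<lambda>(xh, zh, yh). yh) hs)"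
  let ?E = "measure_pmf.expectation (run dev A ?l r \<gamma> \<tau> p ?e0 K) (\<lambda>(hs, _). ?gap hs)"
  define \<Lambda>1 where "\<Lambda>1 = lambda_max (transpose A ** A)"
  define \<Lambda>2 where "\<Lambda>2 = (MAX i. lambda_max_on (coords dev i)
          (transpose (block_cols dev i A) ** block_cols dev i A))"
  define \<Lambda>3 where "\<Lambda>3 = (MAX i. sqrt (lambda_max (block_cols dev i A ** transpose (block_cols dev i A))))"
  have Lpos: "0 < Lr" "0 < Ll" using r_smooth ell_smooth unfolding smooth_def by auto
  note \<gamma> = stepsize_bounds[OF dims_pos Lpos p(1) tau gamma]
  define Q where "Q = {(x, z, y, x, y) | x z y. x \<in> X \<and> z \<in> Z \<and> y \<in> Y}"
  define g :: "('d, 's) half \<Rightarrow> ('d, 's) state \<Rightarrow> real"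
    where "g = (\<lambda>(xh, zh, yh) q. 2 * \<gamma> * (?L xh zh (fst (snd (snd q))) - ?L (fst q) (fst (snd q)) yh))"
  have D2_upper: "(norm (x0 - x))\<^sup>2 + (norm (z0 - z))\<^sup>2 + (norm (y0 - y))\<^sup>2 \<le> D2"
    if "x \<in> X" "z \<in> Z" "y \<in> Y" for x z y
    unfolding D2 by (rule diam2_upper[OF X(1) Z(1) Y(1) that])
  obtain x1 z1 y1 where "x1 \<in> X" "z1 \<in> Z" "y1 \<in> Y" using X Z Y by auto
  from D2_upper[OF this] have D2_nonneg: "0 \<le> D2"
    by (rule order_trans[rotated]) simp
  let ?S = "1 + real CARD('s) / sqrt p * sqrt \<Lambda>1 + real CARD('d) / sqrt p * \<Lambda>3 + Ll + Lr"
  have S: "1 / \<gamma> \<le> 4 * ?S"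
  proof -
    have \<Lambda>1: "0 \<le> \<Lambda>1" unfolding \<Lambda>1_def by (rule lambda_max_on_gram(2)) auto
    have ne: "coords dev i \<noteq> {}" for i using dims_pos by (auto simp: coords_def surj_def) (metis)
    have zero: "block_cols dev i A $ a $ j = 0" if "j \<notin> coords dev i" for i a j
      using that by (simp add: block_cols_def)
    have "\<Lambda>2 \<in> range (\<lambda>i. lambda_max_on (coords dev i) (transpose (block_cols dev i A) ** block_cols dev i A))"
      unfolding \<Lambda>2_def by (rule Max_in) auto
    then obtain i where i: "\<Lambda>2 = lambda_max_on (coords dev i) (transpose (block_cols dev i A) ** block_cols dev i A)"
      by blast
    have \<Lambda>2: "0 \<le> \<Lambda>2" unfolding i by (rule lambda_max_on_gram(2)[OF ne zero])
    have "sqrt \<Lambda>2 \<le> sqrt (lambda_max (block_cols dev i A ** transpose (block_cols dev i A)))"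
      unfolding i using lambda_max_on_gram_le_cogram[OF ne zero] by simp
    also have "\<dots> \<le> \<Lambda>3" unfolding \<Lambda>3_def by (rule Max_ge) auto
    finally have "real CARD('d) / sqrt p * sqrt \<Lambda>2 \<le> real CARD('d) / sqrt p * \<Lambda>3"
      by (rule mult_left_mono) (use p in simp)
    moreover have "sqrt (real CARD('s) * \<Lambda>1 / p) \<le> real CARD('s) / sqrt p * sqrt \<Lambda>1"
      "sqrt (real CARD('d) * \<Lambda>2 / p) \<le> real CARD('d) / sqrt p * sqrt \<Lambda>2"
      by (rule sqrt_mult_card_le; use \<Lambda>1 \<Lambda>2 p in \<open>simp add: Suc_le_eq\<close>)+
    ultimately show "1 / \<gamma> \<le> 4 * ?S"
      using \<gamma>(7) unfolding \<Lambda>1_def[symmetric] \<Lambda>2_def[symmetric] distrib_left by linarith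
  qed
  \<comment> \<open>For \<open>D2 = 0\<close> the sign of \<open>\<kappa>\<close> is undetermined,
    so only the product \<open>\<kappa> * D2\<close> is used.\<close>
  have \<kappa>D2: "0 \<le> (1 + \<kappa>) * D2"
  proof -
    have "0 \<le> \<kappa> * D2" using anchor by (rule order_trans[rotated]) simp
    then show ?thesis using D2_nonneg by (simp add: distrib_right)
  qed
  \<comment> \<open>Scaling the gap by \<open>2 * \<gamma> * real K\<close> undoes the averaging and
    the factor in \<open>g\<close>. The variance surplus \<open>1 / 5\<close> makes the leading
    factor 6.\<close>
  have "measure_pmf.expectation (run dev A ?l r \<gamma> \<tau> p ?e0 K) (\<lambda>(hs, _). 2 * \<gamma> * real K * ?gap hs)
    \<le> (1 + 1 / (1 / 5)) * ((3 + 2 * \<kappa>) * D2)"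
  proof (rule expectation_run_le[where \<kappa> = "step dev A ?l r \<gamma> \<tau> p" and g = g and Q = Q
        and rn = "run dev A ?l r \<gamma> \<tau> p ?e0"])
    show "run dev A ?l r \<gamma> \<tau> p ?e0 0 = return_pmf ([], ?e0)" by simp
    show "run dev A ?l r \<gamma> \<tau> p ?e0 (Suc K) = bind_pmf (run dev A ?l r \<gamma> \<tau> p ?e0 K)
      (\<lambda>(hs, e). map_pmf (\<lambda>(h, e'). (hs @ [h], e')) (step dev A ?l r \<gamma> \<tau> p e))" for K by simp
    show "finite (set_pmf (step dev A ?l r \<gamma> \<tau> p e))" for e by (rule finite_set_pmf_step)
    show "measure_pmf.expectation (step dev A ?l r \<gamma> \<tau> p e) (\<lambda>t. (norm (snd t - q))\<^sup>2)
        + 1 / 5 * measure_pmf.expectation (step dev A ?l r \<gamma> \<tau> p e)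
            (\<lambda>t. (norm (snd t - measure_pmf.expectation (step dev A ?l r \<gamma> \<tau> p e) snd))\<^sup>2)
        + g h q \<le> (norm (e - q))\<^sup>2"
      if h: "h \<in> fst ` set_pmf (step dev A ?l r \<gamma> \<tau> p e)" and q: "q \<in> Q" for e h q
    proof -
      obtain x z y w u where e: "e = (x, z, y, w, u)" by (metis surj_pair)
      obtain xh zh yh where h': "h = (xh, zh, yh)" by (metis surj_pair)
      obtain qx qz qy where q': "q = (qx, qz, qy, qx, qy)" using q by (auto simp: Q_def)
      have "half_point dev A ?l r \<gamma> \<tau> (x, z, y, w, u) = (xh, zh, yh)"
        using fst_step[OF h] by (simp add: e h')
      from step_descent[OF dims_pos r_block r_smooth r_convex ell_smooth ell_convex p tau \<gamma>(1-6) this]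
      show ?thesis by (simp add: e h' q' g_def)
    qed
    \<comment> \<open>One \<open>D2\<close> for the iterates, two for the anchors after doubling
      about \<open>(x0, y0)\<close>, and \<open>2 * \<kappa>\<close> for the offset of the
      anchors.\<close>
    show "(norm (?e0 - q))\<^sup>2 \<le> (3 + 2 * \<kappa>) * D2" if q: "q \<in> Q" for q
    proof -
      obtain x z y where q': "q = (x, z, y, x, y)" and in': "x \<in> X" "z \<in> Z" "y \<in> Y"
        using q by (auto simp: Q_def)
      have n: "(norm (v - t))\<^sup>2 \<le> 2 * (norm (v - v0))\<^sup>2 + 2 * (norm (v0 - t))\<^sup>2" for v t v0 :: "real ^ 'k::finite"
      proof -
        have "(norm (v - t))\<^sup>2 \<le> (norm (v - v0) + norm (v0 - t))\<^sup>2"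
          using norm_triangle_ineq[of "v - v0" "v0 - t"] by (intro power_mono) auto
        also have "\<dots> \<le> 2 * (norm (v - v0))\<^sup>2 + 2 * (norm (v0 - t))\<^sup>2"
          using sum_squares_bound[of "norm (v - v0)" "norm (v0 - t)"] by (simp add: power2_sum)
        finally show ?thesis .
      qed
      have "(norm (?e0 - q))\<^sup>2 = (norm (x0 - x))\<^sup>2 + (norm (z0 - z))\<^sup>2 + (norm (y0 - y))\<^sup>2
          + (norm (w0 - x))\<^sup>2 + (norm (u0 - y))\<^sup>2"
        by (simp add: q' norm_Pair)
      moreover have "0 \<le> (norm (z0 - z))\<^sup>2" by simp
      ultimately show ?thesis
        using D2_upper[OF in'] anchor n[of w0 x x0] n[of u0 y y0] unfolding distrib_right by linarith
    qed
    show "2 * \<gamma> * real K * ?gap hs \<le> M"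
      if len: "length hs = K" and M: "\<And>q. q \<in> Q \<Longrightarrow> (\<Sum>h\<leftarrow>hs. g h q) \<le> M" for hs M
    proof -
      have "?gap hs \<le> (M / (2 * \<gamma>)) / real (length hs)"
      proof (rule gap_avg_le[OF r_block r_convex ell_convex _ X(2) Z(2) Y(2)])
        show "hs \<noteq> []" using len K by auto
        fix x z y assume "x \<in> X" "z \<in> Z" "y \<in> Y"
        then have "(\<Sum>h\<leftarrow>hs. g h (x, z, y, x, y)) \<le> M" by (intro M) (auto simp: Q_def)
        moreover have "(\<Sum>h\<leftarrow>hs. g h (x, z, y, x, y)) =
            2 * \<gamma> * (\<Sum>(xh, zh, yh)\<leftarrow>hs. ?L xh zh y - ?L x z yh)"
          by (simp add: g_def case_prod_unfold sum_list_const_mult)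
        ultimately show "(\<Sum>(xh, zh, yh)\<leftarrow>hs. ?L xh zh y - ?L x z yh) \<le> M / (2 * \<gamma>)"
          using \<gamma>(1) by (simp add: field_simps)
      qed
      then show ?thesis using \<gamma>(1) K by (simp add: len field_simps)
    qed
  qed simp
  then have "2 * \<gamma> * real K * ?E \<le> 6 * ((3 + 2 * \<kappa>) * D2)"
    by (simp add: case_prod_unfold)
  also have "\<dots> \<le> 18 * ((1 + \<kappa>) * D2)"
  proof -
    have "0 \<le> \<kappa> * D2" using anchor by (rule order_trans[rotated]) simp
    then show ?thesis by (simp add: algebra_simps)
  qed
  finally have "?E \<le> 9 * ((1 + \<kappa>) * D2) * (1 / \<gamma>) / real K"
    using \<gamma>(1) K by (simp add: field_simps)
  also have "\<dots> \<le> 9 * ((1 + \<kappa>) * D2) * (4 * ?S) / real K"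
  proof (intro divide_right_mono mult_left_mono S)
    show "0 \<le> 9 * ((1 + \<kappa>) * D2)" using \<kappa>D2 by simp
  qed simp
  \<comment> \<open>The constant 36 is 18 / 2 from the descent times 4 from the step size; the rest
    up to 1000 is slack.\<close>
  also have "\<dots> = 36 * ((1 + \<kappa>) * (?S * (D2 / real K)))" by simp
  also have "\<dots> \<le> 1000 * ((1 + \<kappa>) * (?S * (D2 / real K)))"
  proof -
    have "0 \<le> 4 * ?S" by (rule order_trans[OF _ S]) (use \<gamma>(1) in simp)
    then have "0 \<le> ?S * (((1 + \<kappa>) * D2) / real K)" using \<kappa>D2 by simp
    also have "?S * (((1 + \<kappa>) * D2) / real K) = (1 + \<kappa>) * (?S * (D2 / real K))"
      unfolding times_divide_eq_right by (simp only: mult_ac)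
    finally show ?thesis by (intro mult_right_mono) auto
  qed
  finally show ?thesis unfolding \<Lambda>1_def \<Lambda>3_def by (simp only: mult.assoc)
qed

end
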